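(* Let $\mu$ be a probability measure on $\mathbb{R}$ with a positive density $f$ on $\mathbb{R}$ and cumulative distribution function $F$. Let $g\in L_2(F)$ be absolutely continuous. Then $$\operatorname{Var}(g)\le 4\,[Is(\mu)]^{-2}\,\|g'\|_2^2 .$$ Consequently, if $\lambda_1$ denotes the best constant in the Poincaré inequality for $\mu$, then $$\frac{(Is(\mu))^2}{4}\le\lambda_1 .$$
   Context: Norms and variances are with respect to $\mu$: $\operatorname{Var}(g)=\int(g-\int g\,d\mu)^2d\mu$ and $\|g'\|_2^2=\int|g'|^2d\mu$. Absolutely continuous functions on $\mathbb{R}$ are understood to be absolutely continuous on every compact interval. The best Poincaré constant $\lambda_1$ is the largest $\lambda\ge 0$ such that $\lambda\operatorname{Var}(g)\le\int|g'|^2d\mu$ for every locally Lipschitz function $g$ in $L_2(\mu)$. $Is(\mu)$ is the Cheeger isoperimetric constant: the largest $c\ge 0$ such that $\mu^+(A)\ge c\min\{\mu(A),1-\mu(A)\}$ for all measurable $A\subset\mathbb{R}$, where $\mu^+(A)=\liminf_{h\to0^+}(\mu(A^h)-\mu(A))/h$ and $A^h=\{x:\exists a\in A,\ |x-a|<h\}$. On $\mathbb{R}$, $Is(\mu)=\operatorname{ess\,inf}_{a<x<b}\frac{f(x)}{\min\{F(x),1-F(x)\}}$ (with respect to Lebesgue measure), where $a=\inf\{x:F(x)>0\}$, $b=\sup\{x:F(x)<1\}$. If $Is(\mu)=0$, then $Is(\mu)^{-1}=+\infty$ and the inequality is uninformative. *)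

theory Defs
  imports "HOL-Probability.Probability"
begin

text \<open>
  The classical epsilon-delta notion for real functions; the library's
  \<open>absolutely_continuous\<close> is the unrelated notion for measures. A finite family of
  pairwise non-overlapping intervals is a finite set of pairs (left end, right end).
\<close>

definition abs_continuous_on_interval :: "real \<Rightarrow> real \<Rightarrow> (real \<Rightarrow> real) \<Rightarrow> bool" where
  "abs_continuous_on_interval a b g \<longleftrightarrow>
     (\<forall>\<epsilon>>0. \<exists>\<delta>>0. \<forall>S :: (real \<times> real) set.
        finite S \<longrightarrow>
        (\<forall>(x, y)\<in>S. a \<le> x \<and> x \<le> y \<and> y \<le> b) \<longrightarrow>
        pairwise (\<lambda>p q. disjnt {fst p<..<snd p} {fst q<..<snd q}) S \<longrightarrow>
        (\<Sum>(x, y)\<in>S. y - x) < \<delta> \<longrightarrow>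
        (\<Sum>(x, y)\<in>S. \<bar>g y - g x\<bar>) < \<epsilon>)"

definition locally_abs_continuous :: "(real \<Rightarrow> real) \<Rightarrow> bool" where
  "locally_abs_continuous g \<longleftrightarrow> (\<forall>a b. a < b \<longrightarrow> abs_continuous_on_interval a b g)"

definition locally_Lipschitz :: "(real \<Rightarrow> real) \<Rightarrow> bool" where
  "locally_Lipschitz g \<longleftrightarrow> (\<forall>x. \<exists>r>0. \<exists>L. L-lipschitz_on (cball x r) g)"

definition in_L2 :: "real measure \<Rightarrow> (real \<Rightarrow> real) \<Rightarrow> bool" where
  "in_L2 \<mu> g \<longleftrightarrow> g \<in> borel_measurable \<mu> \<and> integrable \<mu> (\<lambda>x. (g x)\<^sup>2)"

definition Var :: "real measure \<Rightarrow> (real \<Rightarrow> real) \<Rightarrow> real" where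
  "Var \<mu> g = (\<integral>x. (g x - (\<integral>y. g y \<partial>\<mu>))\<^sup>2 \<partial>\<mu>)"

text \<open>
  The squared norm of the derivative, possibly infinite. It is used only for locally
  absolutely continuous or locally Lipschitz \<open>g\<close>, which are differentiable
  Lebesgue-almost everywhere, and for \<open>\<mu>\<close> with a Lebesgue density, so that the value
  of \<open>deriv g\<close> at points where \<open>g\<close> is not differentiable is irrelevant.
\<close>

definition deriv_norm_sq :: "real measure \<Rightarrow> (real \<Rightarrow> real) \<Rightarrow> ennreal" where
  "deriv_norm_sq \<mu> g = (\<integral>\<^sup>+x. ennreal ((deriv g x)\<^sup>2) \<partial>\<mu>)"

definition enlargement :: "real set \<Rightarrow> real \<Rightarrow> real set" where
  "enlargement A h = {x. \<exists>a\<in>A. \<bar>x - a\<bar> < h}"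

definition boundary_measure :: "real measure \<Rightarrow> real set \<Rightarrow> ennreal" where
  "boundary_measure \<mu> A =
     Liminf (at_right 0) (\<lambda>h. (emeasure \<mu> (enlargement A h) - emeasure \<mu> A) / ennreal h)"

text \<open>
  Both best constants are taken in \<open>[0, \<infinity>]\<close>, where the set of admissible constants is
  nonempty and bounded; it is closed, so its supremum is its largest element. By the
  convention \<open>\<infinity> * 0 = 0\<close> of \<open>ennreal\<close>, \<open>\<infinity>\<close> is admissible precisely when every
  finite constant is.
\<close>

definition Is :: "real measure \<Rightarrow> ennreal" where
  "Is \<mu> = Sup {c. \<forall>A\<in>sets \<mu>.
     c * min (emeasure \<mu> A) (1 - emeasure \<mu> A) \<le> boundary_measure \<mu> A}"

definition poincare_const :: "real measure \<Rightarrow> ennreal" where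
  "poincare_const \<mu> = Sup {\<Lambda>. \<forall>g. locally_Lipschitz g \<longrightarrow> in_L2 \<mu> g \<longrightarrow>
     \<Lambda> * ennreal (Var \<mu> g) \<le> deriv_norm_sq \<mu> g}"

end

theory Submission
  imports Defs
begin

text \<open>
  Testing the isoperimetric inequality on the half-lines \<open>{..x}\<close> and applying the Vitali covering
  theorem gives \<open>Is \<mu> * min (F x) (1 - F x) \<le> f x\<close> for almost every \<open>x\<close>. Let \<open>m\<close> be a median and
  \<open>h = g - g m\<close>. Then \<open>h\<^sup>2\<close> is at most the integral of \<open>2 * \<bar>h\<bar> * \<bar>g'\<bar>\<close> between \<open>m\<close> and \<open>x\<close>;
  integrating in \<open>x\<close> and exchanging the integrals yields
  \<open>\<integral> h\<^sup>2 d\<mu> \<le> \<integral> 2 * \<bar>h\<bar> * \<bar>g'\<bar> * min F (1 - F) \<le> \<integral> (2 / Is \<mu>) * \<bar>h\<bar> * \<bar>g'\<bar> d\<mu>\<close>.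
  By AM-GM the last integrand is at most \<open>h\<^sup>2 / 2 + 2 * g'\<^sup>2 / (Is \<mu>)\<^sup>2\<close>, and \<open>\<integral> h\<^sup>2 d\<mu>\<close> is finite, so half
  of it can be absorbed on the left. The bound on \<open>h\<^sup>2\<close> is the fundamental theorem of calculus for
  absolutely continuous functions, which rests on Lebesgue's theorem that monotone functions are
  differentiable almost everywhere.
\<close>

section \<open>Covering intervals and measures\<close>

text \<open>\<open>Is\<close> controls enlargements of sets, whereas the Hardy argument needs a
  pointwise bound on the density. Covering makes the transition: if \<open>q\<close> times length is
  at most \<open>\<nu>\<close> on arbitrarily short intervals around each point of a set, then
  \<open>q\<close> times the Lebesgue measure of the set is at most \<open>\<nu>\<close> of every
  open superset. The same statement serves for \<open>\<mu>\<close> in the density bound and for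
  Stieltjes measures in Lebesgue's theorem.

  The median is the base point because the \<open>x\<close> for which a given \<open>t\<close> lies
  between \<open>m\<close> and \<open>x\<close> form the tail beyond \<open>t\<close> seen from
  \<open>m\<close>, and that tail has measure at most 1/2. With weight s on the square of
  \<open>h\<close> in AM-GM, absorption yields the factor 1 / (s (1 - s)), least at s = 1/2; hence
  the 4.

  In \<open>ennreal\<close> the case \<open>Is \<mu> = 0\<close> still has content: infinity times 0
  is 0, so functions with derivative 0 almost everywhere must be shown to have variance 0.\<close>

text \<open>An interval is the ball about its midpoint with half its length as radius, so Vitali's
  theorem for balls applies. \<open>x\<close> may be an endpoint, since the intervals obtained from
  half-lines start at \<open>x\<close>.\<close>

lemma vitali_intervals:
  fixes E U :: "real set" and P :: "real \<Rightarrow> real \<Rightarrow> bool"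
  assumes "open U" "E \<subseteq> U"
    and cover: "\<And>x d. x \<in> E \<Longrightarrow> d > 0 \<Longrightarrow> \<exists>u v. u \<le> x \<and> x \<le> v \<and> u < v \<and> v - u < d \<and> P u v"
  obtains C where "countable C" "\<And>u v. (u, v) \<in> C \<Longrightarrow> u < v \<and> {u..v} \<subseteq> U \<and> P u v"
    "disjoint_family_on (\<lambda>(u, v). {u..v}) C" "negligible (E - (\<Union>(u, v)\<in>C. {u..v}))"
proof -
  define K where "K = {(u, v). u < v \<and> {u..v} \<subseteq> U \<and> P u v}"
  define a :: "real \<times> real \<Rightarrow> real" where "a = (\<lambda>(u, v). (u + v) / 2)"
  define r :: "real \<times> real \<Rightarrow> real" where "r = (\<lambda>(u, v). (v - u) / 2)"
  have cb: "cball (a i) (r i) = (case i of (u, v) \<Rightarrow> {u..v})" for i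
    by (cases i) (auto simp: a_def r_def cball_eq_atLeastAtMost field_simps)
  have fine: "\<exists>i. i \<in> K \<and> x \<in> cball (a i) (r i) \<and> r i < d" if x: "x \<in> E" and d: "0 < d" for x d
  proof -
    obtain e where e: "e > 0" "cball x e \<subseteq> U"
      using assms x by (meson open_contains_cball subsetD)
    obtain u v where uv: "u \<le> x" "x \<le> v" "u < v" "v - u < min d e" "P u v"
      using cover[OF x, of "min d e"] d e by auto
    have "{u..v} \<subseteq> cball x e" using uv by (auto simp: dist_real_def)
    then have "(u, v) \<in> K" using uv e by (auto simp: K_def)
    moreover have "r (u, v) < d" using uv by (auto simp: r_def)
    moreover have "x \<in> cball (a (u, v)) (r (u, v))" unfolding cb using uv by auto
    ultimately show ?thesis by blast
  qed
  have pos: "0 < r i" if "i \<in> K" for i using that by (auto simp: K_def r_def)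
  obtain C where C: "countable C" "C \<subseteq> K"
     "pairwise (\<lambda>i j. disjnt (cball (a i) (r i)) (cball (a j) (r j))) C"
     "negligible (E - (\<Union>i\<in>C. cball (a i) (r i)))"
    by (rule Vitali_covering_theorem_cballs[of K r E a, OF pos fine])
  show thesis
  proof (rule that)
    show "disjoint_family_on (\<lambda>(u, v). {u..v}) C"
      using C(3) unfolding disjoint_family_on_def pairwise_def disjnt_def cb by blast
    show "negligible (E - (\<Union>(u, v)\<in>C. {u..v}))" using C(4) by (simp add: cb)
    show "u < v \<and> {u..v} \<subseteq> U \<and> P u v" if "(u, v) \<in> C" for u v
      using that C(2) by (auto simp: K_def)
  qed fact
qed

lemma emeasure_lborel_negligible:
  fixes S :: "'a::euclidean_space set"
  shows "S \<in> sets borel \<Longrightarrow> negligible S \<Longrightarrow> emeasure lborel S = 0"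
  by (metis negligible_iff_null_sets null_setsD1 null_sets_completion_iff sets_lborel)

text \<open>Disjoint intervals inside \<open>W\<close> cover almost all of \<open>E\<close>; the
  hypothesis on each of them adds up by countable additivity of both measures.\<close>

lemma vitali_upper_measure_bound:
  fixes E W :: "real set"
  assumes \<nu>: "sets \<nu> = sets borel" and E: "E \<in> sets borel" and W: "open W" "E \<subseteq> W" and q: "q \<ge> 0"
    and cover: "\<And>x d. x \<in> E \<Longrightarrow> d > 0 \<Longrightarrow>
      \<exists>u v. u \<le> x \<and> x \<le> v \<and> u < v \<and> v - u < d \<and> ennreal (q * (v - u)) \<le> emeasure \<nu> {u..v}"
  shows "ennreal q * emeasure lborel E \<le> emeasure \<nu> W"
proof -
  obtain C where C: "countable C"
    "\<And>u v. (u, v) \<in> C \<Longrightarrow> u < v \<and> {u..v} \<subseteq> W \<and> ennreal (q * (v - u)) \<le> emeasure \<nu> {u..v}"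
    "disjoint_family_on (\<lambda>(u, v). {u..v}) C" "negligible (E - (\<Union>(u, v)\<in>C. {u..v}))"
    using vitali_intervals[of W E "\<lambda>u v. ennreal (q * (v - u)) \<le> emeasure \<nu> {u..v}", OF W cover] by metis
  define I :: "real \<times> real \<Rightarrow> real set" where "I = (\<lambda>(u, v). {u..v})"
  have UI: "(\<Union>i\<in>C. I i) \<in> sets borel"
    using C(1) by (intro sets.countable_UN') (auto simp: I_def)
  define Z where "Z = (\<Union>i\<in>C. I i)"
  have Z: "Z \<in> sets borel" using UI by (simp add: Z_def)
  have "emeasure lborel E \<le> emeasure lborel ((E - Z) \<union> Z)"
    using E Z by (intro emeasure_mono) auto
  also have "\<dots> \<le> emeasure lborel (E - Z) + emeasure lborel Z"
    using E Z by (intro emeasure_subadditive) auto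
  also have "emeasure lborel (E - Z) = 0"
    using E C(4) Z by (intro emeasure_lborel_negligible sets.Diff) (auto simp: I_def Z_def)
  finally have "ennreal q * emeasure lborel E \<le> ennreal q * emeasure lborel (\<Union>i\<in>C. I i)"
    by (simp add: mult_left_mono Z_def)
  also have "\<dots> = ennreal q * (\<integral>\<^sup>+i. emeasure lborel (I i) \<partial>count_space C)"
    using C(1,3) by (subst emeasure_UN_countable) (auto simp: I_def)
  also have "\<dots> = (\<integral>\<^sup>+i. ennreal q * emeasure lborel (I i) \<partial>count_space C)"
    by (simp add: nn_integral_cmult)
  also have "\<dots> \<le> (\<integral>\<^sup>+i. emeasure \<nu> (I i) \<partial>count_space C)"
  proof (rule nn_integral_mono)
    fix i assume i: "i \<in> space (count_space C)"
    obtain u v where [simp]: "i = (u, v)" by (cases i)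
    have "u < v" "ennreal (q * (v - u)) \<le> emeasure \<nu> {u..v}" using C(2)[of u v] i by auto
    then show "ennreal q * emeasure lborel (I i) \<le> emeasure \<nu> (I i)"
      using q by (simp add: I_def ennreal_mult)
  qed
  also have "\<dots> = emeasure \<nu> (\<Union>i\<in>C. I i)"
    using C(1,3) by (subst emeasure_UN_countable) (auto simp: I_def \<nu>)
  also have "\<dots> \<le> emeasure \<nu> W"
    using C(2) W by (intro emeasure_mono) (auto simp: I_def \<nu>)
  finally show ?thesis .
qed

text \<open>This direction does not bound \<open>\<nu>\<close> of \<open>E\<close>, since
  \<open>\<nu>\<close> may charge the Lebesgue null set left uncovered. It bounds
  \<open>\<nu>\<close> of an open \<open>W\<close> that exhausts \<open>E\<close> up to measure 0,
  and such a \<open>W\<close> can be fed into \<open>vitali_upper_measure_bound\<close>.\<close>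

lemma vitali_lower_measure_bound:
  fixes E U :: "real set"
  assumes \<nu>: "sets \<nu> = sets borel" and E: "E \<in> sets borel" and U: "open U" "E \<subseteq> U" and p: "p \<ge> 0"
    and cover: "\<And>x d. x \<in> E \<Longrightarrow> d > 0 \<Longrightarrow>
      \<exists>u v. u \<le> x \<and> x \<le> v \<and> u < v \<and> v - u < d \<and> emeasure \<nu> {u..v} \<le> ennreal (p * (v - u))"
  obtains W where "open W" "W \<subseteq> U" "emeasure lborel (E - W) = 0"
    "emeasure \<nu> W \<le> ennreal p * emeasure lborel U"
proof -
  obtain C where C: "countable C"
    "\<And>u v. (u, v) \<in> C \<Longrightarrow> u < v \<and> {u..v} \<subseteq> U \<and> emeasure \<nu> {u..v} \<le> ennreal (p * (v - u))"
    "disjoint_family_on (\<lambda>(u, v). {u..v}) C" "negligible (E - (\<Union>(u, v)\<in>C. {u..v}))"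
    using vitali_intervals[of U E "\<lambda>u v. emeasure \<nu> {u..v} \<le> ennreal (p * (v - u))", OF U cover] by metis
  define I :: "real \<times> real \<Rightarrow> real set" where "I = (\<lambda>(u, v). {u..v})"
  define W :: "real set" where "W = (\<Union>(u, v)\<in>C. {u<..<v})"
  have UI: "(\<Union>i\<in>C. I i) \<in> sets borel"
    using C(1) by (intro sets.countable_UN') (auto simp: I_def)
  have opW: "open W" by (auto simp: W_def)
  \<comment> \<open>Passing to open intervals loses only their endpoints, a countable set.\<close>
  have "E - W \<subseteq> (E - (\<Union>i\<in>C. I i)) \<union> (fst ` C \<union> snd ` C)"
    by (force simp: W_def I_def)
  moreover have "negligible (fst ` C \<union> snd ` C)"
    using C(1) by (simp add: countable_imp_null_set_lborel negligible_iff_null_sets null_sets_completionI)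
  ultimately have "negligible (E - W)"
    using C(4) negligible_subset negligible_Un unfolding I_def by metis
  then have neg: "emeasure lborel (E - W) = 0"
    using E opW by (intro emeasure_lborel_negligible) auto
  have "emeasure \<nu> W \<le> emeasure \<nu> (\<Union>i\<in>C. I i)"
    using UI unfolding I_def W_def by (intro emeasure_mono UN_mono) (auto simp: \<nu>)
  also have "\<dots> = (\<integral>\<^sup>+i. emeasure \<nu> (I i) \<partial>count_space C)"
    using C(1,3) by (subst emeasure_UN_countable) (auto simp: I_def \<nu>)
  also have "\<dots> \<le> (\<integral>\<^sup>+i. ennreal p * emeasure lborel (I i) \<partial>count_space C)"
  proof (rule nn_integral_mono)
    fix i assume i: "i \<in> space (count_space C)"
    obtain u v where [simp]: "i = (u, v)" by (cases i)
    have "u < v" "emeasure \<nu> {u..v} \<le> ennreal (p * (v - u))" using C(2)[of u v] i by auto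
    then show "emeasure \<nu> (I i) \<le> ennreal p * emeasure lborel (I i)"
      using p by (simp add: I_def ennreal_mult)
  qed
  also have "\<dots> = ennreal p * emeasure lborel (\<Union>i\<in>C. I i)"
    using C(1,3) by (subst emeasure_UN_countable) (auto simp: I_def nn_integral_cmult)
  also have "\<dots> \<le> ennreal p * emeasure lborel U"
    using C(2) U by (intro mult_left_mono emeasure_mono) (auto simp: I_def)
  finally have "emeasure \<nu> W \<le> ennreal p * emeasure lborel U" .
  moreover have "W \<subseteq> U"
  proof
    fix x assume "x \<in> W"
    then obtain u v where "(u, v) \<in> C" "x \<in> {u<..<v}" by (auto simp: W_def)
    then show "x \<in> U" using C(2)[of u v] by auto
  qed
  ultimately show thesis using that opW neg by blast
qed

text \<open>For fixed \<open>d\<close> the set is a union of open intervals, whatever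
  \<open>P\<close> is; this is where strict straddling is used. Restricting \<open>d\<close> to 1 /
  (n + 1) makes the intersection countable.\<close>

lemma borel_straddle_limsup_set:
  fixes P :: "real \<Rightarrow> real \<Rightarrow> bool"
  shows "{x. \<forall>d>0. \<exists>u v. u < x \<and> x < v \<and> v - u < d \<and> P u v} \<in> sets borel"
proof -
  define G where "G d = {x. \<exists>u v. u < x \<and> x < v \<and> v - u < d \<and> P u v}" for d :: real
  have "G d = (\<Union>u. \<Union>v\<in>{v. v - u < d \<and> P u v}. {u<..<v})" for d
    unfolding G_def by (rule set_eqI, simp only: UN_iff mem_Collect_eq greaterThanLessThan_iff) blast
  then have op: "open (G d)" for d by (simp add: open_UN)
  have mono: "G d \<subseteq> G e" if "d \<le> e" for d e
    using that unfolding G_def by (blast intro: less_le_trans)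
  have "{x. \<forall>d>0. \<exists>u v. u < x \<and> x < v \<and> v - u < d \<and> P u v} = (\<Inter>d\<in>{0<..}. G d)"
    by (auto simp: G_def)
  also have "\<dots> = (\<Inter>n. G (inverse (real (Suc n))))"
  proof (intro subset_antisym INT_greatest)
    fix d :: real assume "d \<in> {0<..}"
    then obtain n where "inverse (real (Suc n)) < d" using reals_Archimedean by auto
    then have "G (inverse (real (Suc n))) \<subseteq> G d" by (intro mono) simp
    then show "(\<Inter>n. G (inverse (real (Suc n)))) \<subseteq> G d" by blast
  qed (intro INT_lower, simp)
  also have "\<dots> \<in> sets borel"
    by (rule sets.countable_INT) (auto simp del: inverse_eq_divide of_nat_Suc intro!: borel_open op)
  finally show ?thesis .
qed

section \<open>Almost everywhere differentiability of monotone functions\<close>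

text \<open>By continuity one endpoint of a straddling interval may be moved to \<open>x\<close>;
  the slopes become one-sided difference quotients, and the non-strict bounds survive the
  limit.\<close>

lemma tendsto_slope_imp_differentiable:
  fixes V :: "real \<Rightarrow> real"
  assumes cont: "continuous_on UNIV V"
    and slope: "\<And>e. e > 0 \<Longrightarrow> \<exists>d>0. \<forall>u v. u < x \<longrightarrow> x < v \<longrightarrow> v - u < d \<longrightarrow> \<bar>V v - V u - L * (v - u)\<bar> \<le> e * (v - u)"
  shows "(V has_real_derivative L) (at x)"
proof -
  have V[tendsto_intros]: "(V \<longlongrightarrow> V y) (at y within S)" for y S
    using cont by (meson UNIV_I continuous_on_def subset_UNIV tendsto_within_subset)
  have "\<exists>d>0. \<forall>y. \<bar>y - x\<bar> < d \<longrightarrow> \<bar>V y - V x - (y - x) * L\<bar> \<le> e * \<bar>y - x\<bar>" if e: "e > 0" for e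
  proof -
    obtain d where d: "d > 0" and D: "\<And>u v. u < x \<Longrightarrow> x < v \<Longrightarrow> v - u < d \<Longrightarrow> \<bar>V v - V u - L * (v - u)\<bar> \<le> e * (v - u)"
      using slope[OF e] by blast
    have "\<bar>V y - V x - (y - x) * L\<bar> \<le> e * \<bar>y - x\<bar>" if y: "\<bar>y - x\<bar> < d" for y
    proof (cases y x rule: linorder_cases)
      case greater
      have "\<bar>V y - V x - L * (y - x)\<bar> \<le> e * (y - x)"
      proof (rule tendsto_le[where F = "at_left x"])
        have "eventually (\<lambda>u. u \<in> {y - d<..<x}) (at_left x)"
          using y greater by (intro eventually_at_left_real) auto
        then show "\<forall>\<^sub>F u in at_left x. \<bar>V y - V u - L * (y - u)\<bar> \<le> e * (y - u)"
          by eventually_elim (use D greater in auto)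
      qed (auto intro!: tendsto_intros)
      then show ?thesis using greater by (simp add: mult.commute)
    next
      case less
      have "\<bar>V x - V y - L * (x - y)\<bar> \<le> e * (x - y)"
      proof (rule tendsto_le[where F = "at_right x"])
        have "eventually (\<lambda>u. u \<in> {x<..<y + d}) (at_right x)"
          using y less by (intro eventually_at_right_real) auto
        then show "\<forall>\<^sub>F u in at_right x. \<bar>V u - V y - L * (u - y)\<bar> \<le> e * (u - y)"
          by eventually_elim (use D less in auto)
      qed (auto intro!: tendsto_intros)
      then show ?thesis using less by (simp add: algebra_simps abs_if split: if_splits)
    qed simp
    with d show ?thesis by blast
  qed
  then show ?thesis
    unfolding has_field_derivative_def has_derivative_at_alt
    by (auto simp: bounded_linear_mult_right mult.commute[of L])
qed

section \<open>Upper and lower derivates over straddling intervals\<close>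

text \<open>Up to the boundary case of equality, these are the points whose upper derivate exceeds
  \<open>q\<close>. With straddling intervals the set is Borel by
  \<open>borel_straddle_limsup_set\<close>.\<close>

definition limsup_slope_set :: "(real \<Rightarrow> real) \<Rightarrow> real \<Rightarrow> real set" where
  "limsup_slope_set V q = {x. \<forall>d>0. \<exists>u v. u < x \<and> x < v \<and> v - u < d \<and> q * (v - u) < V v - V u}"

definition liminf_slope_set :: "(real \<Rightarrow> real) \<Rightarrow> real \<Rightarrow> real set" where
  "liminf_slope_set V p = {x. \<forall>d>0. \<exists>u v. u < x \<and> x < v \<and> v - u < d \<and> V v - V u < p * (v - u)}"

lemma not_limsup_slope_setD:
  assumes "x \<notin> limsup_slope_set V q"
  shows "\<exists>d>0. \<forall>u v. u < x \<longrightarrow> x < v \<longrightarrow> v - u < d \<longrightarrow> V v - V u \<le> q * (v - u)"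
proof -
  obtain d where "d > 0" and d: "\<not> (\<exists>u v. u < x \<and> x < v \<and> v - u < d \<and> \<not> V v - V u \<le> q * (v - u))"
    using assms unfolding limsup_slope_set_def not_le by blast
  then show ?thesis by blast
qed

lemma not_liminf_slope_setD:
  assumes "x \<notin> liminf_slope_set V p"
  shows "\<exists>d>0. \<forall>u v. u < x \<longrightarrow> x < v \<longrightarrow> v - u < d \<longrightarrow> p * (v - u) \<le> V v - V u"
proof -
  obtain d where "d > 0" and d: "\<not> (\<exists>u v. u < x \<and> x < v \<and> v - u < d \<and> \<not> p * (v - u) \<le> V v - V u)"
    using assms unfolding liminf_slope_set_def not_le by blast
  then show ?thesis by blast
qed

lemma borel_slope_sets:
  "limsup_slope_set V q \<in> sets borel" "liminf_slope_set V q \<in> sets borel"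
  unfolding limsup_slope_set_def liminf_slope_set_def by (rule borel_straddle_limsup_set)+

context
  fixes V :: "real \<Rightarrow> real"
  assumes mono: "mono V" and cont: "continuous_on UNIV V"
begin

lemma emeasure_interval_measure_mono:
  "u \<le> v \<Longrightarrow> emeasure (interval_measure V) {u..v} = ennreal (V v - V u)"
  using mono cont by (intro emeasure_interval_measure_Icc) (auto dest: monoD)

text \<open>The Stieltjes measure of a continuous \<open>V\<close> has no atoms, so a closed
  interval has exactly the increment of \<open>V\<close> as its measure and the covering bound
  applies.\<close>

lemma limsup_slope_set_bound:
  assumes "E \<in> sets borel" "open W" "E \<subseteq> W" "E \<subseteq> limsup_slope_set V q" "q \<ge> 0"
  shows "ennreal q * emeasure lborel E \<le> emeasure (interval_measure V) W"
proof (rule vitali_upper_measure_bound)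
  fix x d :: real assume "x \<in> E" "d > 0"
  then obtain u v where uv: "u < x" "x < v" "v - u < d" "q * (v - u) < V v - V u"
    using assms(4) unfolding limsup_slope_set_def by blast
  then have "ennreal (q * (v - u)) \<le> emeasure (interval_measure V) {u..v}"
    by (simp add: emeasure_interval_measure_mono ennreal_leI)
  with uv show "\<exists>u v. u \<le> x \<and> x \<le> v \<and> u < v \<and> v - u < d \<and>
      ennreal (q * (v - u)) \<le> emeasure (interval_measure V) {u..v}"
    by (intro exI[of _ u] exI[of _ v]) auto
qed (use assms in auto)

text \<open>With \<open>\<nu>\<close> the Stieltjes measure and \<open>U\<close> a close open
  neighbourhood of the set \<open>E\<close>, the low slopes give an open \<open>W\<close> inside
  \<open>U\<close> with \<nu>(W) at most p |U|, and the high slopes give q |E| at most \<nu>(W).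
  Hence q |E| is at most p |E|; the bounded window makes |E| finite, so |E| = 0.\<close>

lemma slope_gap_null:
  assumes "0 \<le> p" "p < q"
  shows "emeasure lborel (liminf_slope_set V p \<inter> limsup_slope_set V q \<inter> {a<..<b}) = 0"
proof (cases "a < b")
  case True
  define E where "E = liminf_slope_set V p \<inter> limsup_slope_set V q \<inter> {a<..<b}"
  have E: "E \<in> sets borel" by (simp add: E_def borel_slope_sets sets.Int)
  have "emeasure lborel E \<le> emeasure lborel {a<..<b}" by (intro emeasure_mono) (auto simp: E_def)
  then have fin: "emeasure lborel E < \<infinity>" using True by (simp add: le_less_trans)
  have "ennreal q * emeasure lborel E \<le> ennreal p * emeasure lborel E + ennreal e" if e: "e > 0" for e :: real
  proof -
    \<comment> \<open>The divisor \<open>p + 1\<close> keeps the error p e / (p + 1) below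
      \<open>e\<close> and is nonzero for p = 0 too.\<close>
    obtain U0 where U0: "open U0" "E \<subseteq> U0" "emeasure lborel (U0 - E) < ennreal (e / (p + 1))"
      using outer_regular_lborel[OF E, of "e / (p + 1)"] e assms(1) by auto
    define U where "U = U0 \<inter> {a<..<b}"
    have U: "open U" "E \<subseteq> U" using U0 by (auto simp: U_def E_def)
    have "emeasure lborel U = emeasure lborel (E \<union> (U - E))" using U by (metis Diff_partition)
    also have "\<dots> \<le> emeasure lborel E + emeasure lborel (U - E)"
      using U E by (intro emeasure_subadditive) auto
    also have "emeasure lborel (U - E) \<le> emeasure lborel (U0 - E)"
      using U0 E by (intro emeasure_mono) (auto simp: U_def)
    finally have eU: "emeasure lborel U \<le> emeasure lborel E + ennreal (e / (p + 1))"
      using U0(3) by (meson add_left_mono le_less_trans less_imp_le order_trans)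
    have cov: "\<exists>u v. u \<le> x \<and> x \<le> v \<and> u < v \<and> v - u < d \<and>
        emeasure (interval_measure V) {u..v} \<le> ennreal (p * (v - u))" if xd: "x \<in> E" "d > 0" for x d
    proof -
      obtain u v where uv: "u < x" "x < v" "v - u < d" "V v - V u < p * (v - u)"
        using xd unfolding E_def liminf_slope_set_def by blast
      then have "emeasure (interval_measure V) {u..v} \<le> ennreal (p * (v - u))"
        by (simp add: emeasure_interval_measure_mono ennreal_leI)
      with uv show ?thesis by (intro exI[of _ u] exI[of _ v]) auto
    qed
    obtain W where W: "open W" "W \<subseteq> U" "emeasure lborel (E - W) = 0"
        "emeasure (interval_measure V) W \<le> ennreal p * emeasure lborel U"
      using vitali_lower_measure_bound[OF _ E U assms(1) cov] by auto
    have "emeasure lborel E = emeasure lborel ((E - W) \<union> (E \<inter> W))" by (rule arg_cong) blast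
    also have "\<dots> \<le> emeasure lborel (E - W) + emeasure lborel (E \<inter> W)"
      using E W(1) by (intro emeasure_subadditive) auto
    finally have "emeasure lborel E \<le> emeasure lborel (E - W) + emeasure lborel (E \<inter> W)" .
    then have "ennreal q * emeasure lborel E \<le> ennreal q * emeasure lborel (E \<inter> W)"
      using W(3) by (simp add: mult_left_mono)
    also have "\<dots> \<le> emeasure (interval_measure V) W"
      using E W assms by (intro limsup_slope_set_bound) (auto simp: E_def)
    also have "\<dots> \<le> ennreal p * (emeasure lborel E + ennreal (e / (p + 1)))"
      using W(4) eU by (meson mult_left_mono order_trans zero_le)
    also have "\<dots> = ennreal p * emeasure lborel E + ennreal (p * (e / (p + 1)))"
      using assms e by (simp add: distrib_left ennreal_mult[symmetric])
    also have "\<dots> \<le> ennreal p * emeasure lborel E + ennreal e"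
      using assms e by (intro add_left_mono ennreal_leI) (simp add: field_simps)
    finally show ?thesis .
  qed
  then have "ennreal q * emeasure lborel E \<le> ennreal p * emeasure lborel E"
    by (rule ennreal_le_epsilon)
  moreover obtain m where m: "emeasure lborel E = ennreal m" "m \<ge> 0"
    using fin by (cases "emeasure lborel E") auto
  ultimately have "q * m \<le> p * m"
    using assms by (simp add: ennreal_mult[symmetric] ennreal_le_iff)
  then have "m = 0" using assms m(2) by (smt (verit) mult_right_mono mult_less_cancel_right)
  then show ?thesis using m by (simp add: E_def)
qed simp

text \<open>The covering bound at level \<open>n\<close> makes \<open>n\<close> times the measure at
  most \<open>V b - V a\<close>, for every \<open>n\<close>.\<close>

lemma infinite_slope_null:
  "emeasure lborel ((\<Inter>n. limsup_slope_set V (real n)) \<inter> {a<..<b}) = 0"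
proof -
  define E where "E = (\<Inter>n. limsup_slope_set V (real n)) \<inter> {a<..<b}"
  have E: "E \<in> sets borel" unfolding E_def
    by (intro sets.Int sets.countable_INT) (auto simp: borel_slope_sets)
  have bd: "ennreal (real n) * emeasure lborel E \<le> ennreal (V b - V a)" if "a < b" for n
  proof -
    have "ennreal (real n) * emeasure lborel E \<le> emeasure (interval_measure V) {a<..<b}"
      using E by (intro limsup_slope_set_bound) (auto simp: E_def)
    also have "\<dots> \<le> emeasure (interval_measure V) {a..b}" by (intro emeasure_mono) auto
    finally show ?thesis using that by (simp add: emeasure_interval_measure_mono)
  qed
  have "emeasure lborel E = 0"
  proof (cases "a < b")
    case True
    have "emeasure lborel E \<le> emeasure lborel {a<..<b}" by (intro emeasure_mono) (auto simp: E_def)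
    then have fin: "emeasure lborel E < \<infinity>" using True by (simp add: le_less_trans)
    then obtain m where m: "emeasure lborel E = ennreal m" "m \<ge> 0" by (cases "emeasure lborel E") auto
    have V: "V b - V a \<ge> 0" using True mono by (simp add: monoD)
    have "real n * m \<le> V b - V a" for n
      using bd[OF True, of n] m V by (simp add: ennreal_mult[symmetric] ennreal_le_iff del: ennreal_of_nat_eq_real_of_nat)
    then have "m = 0" using m(2) by (metis less_eq_real_def linorder_not_less reals_Archimedean3)
    then show ?thesis using m by simp
  qed (simp add: E_def)
  then show ?thesis by (simp add: E_def)
qed

text \<open>The derivative is the infimum \<open>L\<close> of the nonnegative levels
  \<open>q\<close> whose upper set misses \<open>x\<close>. For the lower bound take rationals p < q
  just below \<open>L\<close>: \<open>x\<close> lies in the upper set at \<open>q\<close>, hence by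
  \<open>gap\<close> outside the lower set at \<open>p\<close>.\<close>

lemma differentiable_if_slopes:
  assumes gap: "\<And>p q. p \<in> \<rat> \<Longrightarrow> q \<in> \<rat> \<Longrightarrow> 0 \<le> p \<Longrightarrow> p < q \<Longrightarrow> x \<notin> liminf_slope_set V p \<or> x \<notin> limsup_slope_set V q"
    and fin: "x \<notin> limsup_slope_set V (real n)"
  shows "V differentiable (at x)"
proof -
  define Q where "Q = {q. q \<ge> 0 \<and> x \<notin> limsup_slope_set V q}"
  define L where "L = Inf Q"
  have Q: "Q \<noteq> {}" "bdd_below Q" 
    using fin by (auto simp: Q_def intro!: bdd_belowI[of _ 0]) (use of_nat_0_le_iff in blast)
  have L0: "L \<ge> 0" unfolding L_def using Q by (intro cInf_greatest) (auto simp: Q_def)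
  have upper: "\<exists>d>0. \<forall>u v. u < x \<longrightarrow> x < v \<longrightarrow> v - u < d \<longrightarrow> V v - V u \<le> (L + e) * (v - u)" if e: "e > 0" for e
  proof -
    obtain q where q: "q \<in> Q" "q < L + e"
      using Q e unfolding L_def by (metis cInf_lessD less_add_same_cancel1)
    then obtain d where d: "d > 0" "\<And>u v. u < x \<Longrightarrow> x < v \<Longrightarrow> v - u < d \<Longrightarrow> V v - V u \<le> q * (v - u)"
      using not_limsup_slope_setD[of x V q] by (auto simp: Q_def)
    have "V v - V u \<le> (L + e) * (v - u)" if "u < x" "x < v" "v - u < d" for u v
      using d(2)[OF that] q(2) that by (smt (verit) mult_right_mono)
    with d(1) show ?thesis by blast
  qed
  have lower: "\<exists>d>0. \<forall>u v. u < x \<longrightarrow> x < v \<longrightarrow> v - u < d \<longrightarrow> (L - e) * (v - u) \<le> V v - V u" if e: "e > 0" for e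
  \<comment> \<open>\<open>gap\<close> concerns nonnegative levels; for a negative slope the bound
    is the monotonicity of \<open>V\<close>.\<close>
  proof (cases "L - e < 0")
    case True
    have "(L - e) * (v - u) \<le> V v - V u" if "u < x" "x < v" for u v
    proof -
      have "(L - e) * (v - u) \<le> 0" using True that by (intro mult_nonpos_nonneg) auto
      also have "0 \<le> V v - V u" using mono that by (simp add: monoD)
      finally show ?thesis .
    qed
    then show ?thesis by (intro exI[of _ 1]) auto
  next
    case False
    obtain p where p: "p \<in> \<rat>" "L - e < p" "p < L" using Rats_dense_in_real[of "L - e" L] e by auto
    obtain q where q: "q \<in> \<rat>" "p < q" "q < L" using Rats_dense_in_real[OF p(3)] by auto
    have "q \<notin> Q" using q Q unfolding L_def by (meson cInf_lower leD)
    then have "x \<in> limsup_slope_set V q" using p q False by (auto simp: Q_def)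
    then have "x \<notin> liminf_slope_set V p" using gap p q False by auto
    then obtain d where d: "d > 0" "\<And>u v. u < x \<Longrightarrow> x < v \<Longrightarrow> v - u < d \<Longrightarrow> p * (v - u) \<le> V v - V u"
      using not_liminf_slope_setD[of x V p] by auto
    have "(L - e) * (v - u) \<le> V v - V u" if "u < x" "x < v" "v - u < d" for u v
      using d(2)[OF that] p(2) that by (smt (verit) mult_right_mono)
    with d(1) show ?thesis by blast
  qed
  have "(V has_real_derivative L) (at x)"
  proof (rule tendsto_slope_imp_differentiable[OF cont])
    fix e :: real assume e: "e > 0"
    obtain d1 where d1: "d1 > 0" "\<And>u v. u < x \<Longrightarrow> x < v \<Longrightarrow> v - u < d1 \<Longrightarrow> V v - V u \<le> (L + e) * (v - u)"
      using upper[OF e] by blast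
    obtain d2 where d2: "d2 > 0" "\<And>u v. u < x \<Longrightarrow> x < v \<Longrightarrow> v - u < d2 \<Longrightarrow> (L - e) * (v - u) \<le> V v - V u"
      using lower[OF e] by blast
    have "\<bar>V v - V u - L * (v - u)\<bar> \<le> e * (v - u)" if "u < x" "x < v" "v - u < min d1 d2" for u v
      using d1(2)[of u v] d2(2)[of u v] that by (simp add: algebra_simps abs_le_iff)
    then show "\<exists>d>0. \<forall>u v. u < x \<longrightarrow> x < v \<longrightarrow> v - u < d \<longrightarrow> \<bar>V v - V u - L * (v - u)\<bar> \<le> e * (v - u)"
      using d1(1) d2(1) by (intro exI[of _ "min d1 d2"]) auto
  qed
  then show ?thesis using real_differentiable_def by blast
qed

lemma AE_differentiable_mono_continuous: "AE x in lborel. V differentiable (at x)"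
proof -
  have 1: "AE x in lborel. \<forall>n::nat. \<forall>p\<in>\<rat>. \<forall>q\<in>\<rat>. 0 \<le> p \<longrightarrow> p < q \<longrightarrow>
    x \<notin> liminf_slope_set V p \<inter> limsup_slope_set V q \<inter> {- real n<..<real n}"
  proof (intro AE_all_countable[THEN iffD2] AE_ball_countable[OF countable_rat, THEN iffD2] allI ballI)
    fix n :: nat and p q :: real
    show "AE x in lborel. 0 \<le> p \<longrightarrow> p < q \<longrightarrow>
        x \<notin> liminf_slope_set V p \<inter> limsup_slope_set V q \<inter> {- real n<..<real n}"
    proof (cases "0 \<le> p \<and> p < q")
      case True
      then have "liminf_slope_set V p \<inter> limsup_slope_set V q \<inter> {- real n<..<real n} \<in> null_sets lborel"
        using slope_gap_null[of p q "- real n" "real n"] by (intro null_setsI) (auto intro!: borel_slope_sets sets.Int)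
      then show ?thesis by (rule AE_mp[OF AE_not_in, OF _ AE_I2]) blast
    qed auto
  qed
  have 2: "AE x in lborel. \<forall>n::nat. x \<notin> (\<Inter>k. limsup_slope_set V (real k)) \<inter> {- real n<..<real n}"
    unfolding AE_all_countable
    by (intro allI AE_not_in null_setsI infinite_slope_null sets.Int sets.countable_INT)
       (auto simp: borel_slope_sets)
  from 1 2 show ?thesis
  proof eventually_elim
    case (elim x)
    obtain n where n: "\<bar>x\<bar> < real n" using reals_Archimedean2 by blast
    then have xn: "x \<in> {- real n<..<real n}" by auto
    have "\<exists>k. x \<notin> limsup_slope_set V (real k)" using elim(2) xn by blast
    then obtain k where k: "x \<notin> limsup_slope_set V (real k)" by blast
    have "x \<notin> liminf_slope_set V p \<or> x \<notin> limsup_slope_set V q"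
      if "p \<in> \<rat>" "q \<in> \<rat>" "0 \<le> p" "p < q" for p q
      using elim(1) that xn by blast
    then show ?case using differentiable_if_slopes k by blast
  qed
qed

end

section \<open>Absolutely continuous functions\<close>

text \<open>The index will be a position in a partition or a tagged interval. Strictness of
  \<open>u i < v i\<close> matters: two indices with the same endpoints would have a nonempty open
  interval disjoint from itself, so passing to the set of pairs loses no summand.\<close>

lemma abs_continuous_indexed:
  assumes ac: "abs_continuous_on_interval a b g" and "\<epsilon> > 0"
  obtains \<delta> where "\<delta> > 0"
    "\<And>(I :: 'i set) u v. finite I \<Longrightarrow> (\<And>i. i \<in> I \<Longrightarrow> a \<le> u i \<and> u i < v i \<and> v i \<le> b) \<Longrightarrow>
       disjoint_family_on (\<lambda>i. {u i<..<v i}) I \<Longrightarrow> (\<Sum>i\<in>I. v i - u i) < \<delta> \<Longrightarrow>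
       (\<Sum>i\<in>I. \<bar>g (v i) - g (u i)\<bar>) < \<epsilon>"
proof -
  obtain \<delta> where \<delta>: "\<delta> > 0" and D: "\<forall>S :: (real \<times> real) set. finite S \<longrightarrow>
       (\<forall>(x, y)\<in>S. a \<le> x \<and> x \<le> y \<and> y \<le> b) \<longrightarrow>
       pairwise (\<lambda>p q. disjnt {fst p<..<snd p} {fst q<..<snd q}) S \<longrightarrow>
       (\<Sum>(x, y)\<in>S. y - x) < \<delta> \<longrightarrow> (\<Sum>(x, y)\<in>S. \<bar>g y - g x\<bar>) < \<epsilon>"
    using ac[unfolded abs_continuous_on_interval_def, THEN spec, THEN mp, OF \<open>\<epsilon> > 0\<close>] by blast
  show thesis
  proof (rule that[OF \<delta>])
    fix I :: "'i set" and u v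
    assume I: "finite I" and uv: "\<And>i. i \<in> I \<Longrightarrow> a \<le> u i \<and> u i < v i \<and> v i \<le> b"
      and disj: "disjoint_family_on (\<lambda>i. {u i<..<v i}) I" and len: "(\<Sum>i\<in>I. v i - u i) < \<delta>"
    define h where "h i = (u i, v i)" for i
    have inj: "inj_on h I"
    proof (rule inj_onI, rule ccontr)
      fix i j assume ij: "i \<in> I" "j \<in> I" "h i = h j" "i \<noteq> j"
      then have "{u i<..<v i} \<inter> {u i<..<v i} = {}"
        using disj unfolding disjoint_family_on_def h_def by (metis Pair_inject)
      then show False using uv[OF ij(1)] by simp
    qed
    have "(\<Sum>(x, y)\<in>h ` I. \<bar>g y - g x\<bar>) < \<epsilon>"
    proof (rule D[rule_format])
      show "pairwise (\<lambda>p q. disjnt {fst p<..<snd p} {fst q<..<snd q}) (h ` I)"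
        using disj unfolding pairwise_def disjoint_family_on_def disjnt_def h_def by auto
      show "(\<Sum>(x, y)\<in>h ` I. y - x) < \<delta>"
        using len by (simp add: sum.reindex[OF inj], simp add: h_def)
    qed (use I uv in \<open>auto simp: h_def less_imp_le\<close>)
    then show "(\<Sum>i\<in>I. \<bar>g (v i) - g (u i)\<bar>) < \<epsilon>"
      by (simp add: sum.reindex[OF inj], simp add: h_def)
  qed
qed

section \<open>Variation sums and total variation\<close>

text \<open>A partition is a monotone sequence with repetitions allowed, so that truncating it by
  \<open>min\<close> or \<open>max\<close> with a point gives a partition with the same number of
  steps.\<close>

definition variation_sum :: "(real \<Rightarrow> real) \<Rightarrow> nat \<Rightarrow> (nat \<Rightarrow> real) \<Rightarrow> real" where
  "variation_sum g n p = (\<Sum>i<n. \<bar>g (p (Suc i)) - g (p i)\<bar>)"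

lemma abs_continuous_variation_sum:
  assumes ac: "abs_continuous_on_interval a b g" and "\<epsilon> > 0"
  obtains \<delta> where "\<delta> > 0"
    "\<And>n p x y. mono p \<Longrightarrow> range p \<subseteq> {x..y} \<Longrightarrow> a \<le> x \<Longrightarrow> y \<le> b \<Longrightarrow> y - x < \<delta> \<Longrightarrow> variation_sum g n p < \<epsilon>"
proof -
  obtain \<delta> where \<delta>: "\<delta> > 0" and D: "\<And>(I :: nat set) u v. finite I \<Longrightarrow> (\<And>i. i \<in> I \<Longrightarrow> a \<le> u i \<and> u i < v i \<and> v i \<le> b) \<Longrightarrow>
       disjoint_family_on (\<lambda>i. {u i<..<v i}) I \<Longrightarrow> (\<Sum>i\<in>I. v i - u i) < \<delta> \<Longrightarrow>
       (\<Sum>i\<in>I. \<bar>g (v i) - g (u i)\<bar>) < \<epsilon>"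
    by (rule abs_continuous_indexed[OF assms, where ?'i = nat]) blast
  show thesis
  proof (rule that[OF \<delta>])
    fix n :: nat and p :: "nat \<Rightarrow> real" and x y
    assume p: "mono p" "range p \<subseteq> {x..y}" and xy: "a \<le> x" "y \<le> b" "y - x < \<delta>"
    \<comment> \<open>Steps of length 0 contribute nothing and are dropped, because the indexed form
      asks for nondegenerate intervals.\<close>
    define I where "I = {i. i < n \<and> p i < p (Suc i)}"
    have le: "p i \<le> p (Suc i)" for i using p(1) by (simp add: monoD)
    have bd: "x \<le> p i" "p i \<le> y" for i using p(2) by (auto simp: subset_iff)
    have "(\<Sum>i\<in>I. \<bar>g (p (Suc i)) - g (p i)\<bar>) < \<epsilon>"
    proof (rule D)
      have "{p i<..<p (Suc i)} \<inter> {p j<..<p (Suc j)} = {}" if "i < j" for i j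
      proof -
        have "p (Suc i) \<le> p j" using p(1) that by (simp add: monoD Suc_leI)
        then show ?thesis by auto
      qed
      then show "disjoint_family_on (\<lambda>i. {p i<..<p (Suc i)}) I"
        unfolding disjoint_family_on_def by (metis inf_commute linorder_neqE_nat)
      have "(\<Sum>i\<in>I. p (Suc i) - p i) \<le> (\<Sum>i<n. p (Suc i) - p i)"
        using le by (intro sum_mono2) (auto simp: I_def)
      also have "\<dots> = p n - p 0" by (rule sum_lessThan_telescope)
      also have "\<dots> < \<delta>" using bd[of n] bd[of 0] xy by linarith
      finally show "(\<Sum>i\<in>I. p (Suc i) - p i) < \<delta>" .
      show "a \<le> p i \<and> p i < p (Suc i) \<and> p (Suc i) \<le> b" if "i \<in> I" for i
        using that bd[of i] bd[of "Suc i"] xy by (auto simp: I_def)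
    qed (simp add: I_def)
    also have "(\<Sum>i\<in>I. \<bar>g (p (Suc i)) - g (p i)\<bar>) = variation_sum g n p"
      unfolding variation_sum_def I_def
      by (rule sum.mono_neutral_left) (use le in \<open>auto simp: less_le\<close>)
    finally show "variation_sum g n p < \<epsilon>" .
  qed
qed

lemma mono_min_max_const:
  fixes p :: "nat \<Rightarrow> real"
  assumes "mono p"
  shows "mono (\<lambda>i. min (p i) t)" "mono (\<lambda>i. max (p i) t)"
  using assms unfolding mono_def by (meson min.mono max.mono order_refl)+

text \<open>Truncation at \<open>t\<close> replaces refinement of partitions: g z = g (min z t) + g
  (max z t) - g t for every \<open>z\<close>, and the triangle inequality applies to each
  step.\<close>

lemma variation_sum_split:
  "variation_sum g n p \<le> variation_sum g n (\<lambda>i. min (p i) t) + variation_sum g n (\<lambda>i. max (p i) t)"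
proof -
  have *: "g z = g (min z t) + g (max z t) - g t" for z by (cases "z \<le> t") (auto simp: min_def max_def)
  have "\<bar>g (p (Suc i)) - g (p i)\<bar> \<le>
      \<bar>g (min (p (Suc i)) t) - g (min (p i) t)\<bar> + \<bar>g (max (p (Suc i)) t) - g (max (p i) t)\<bar>" for i
    using *[of "p i"] *[of "p (Suc i)"] by linarith
  then show ?thesis
    unfolding variation_sum_def sum.distrib[symmetric] by (intro sum_mono)
qed

text \<open>The interval is cut into blocks of length \<delta> / 2, each carrying variation below 1;
  half of \<delta>, because the modulus asks for length strictly below \<delta>. Induction on the
  number of blocks splits off the last one.\<close>

lemma variation_sum_bounded:
  assumes ac: "abs_continuous_on_interval a b g"
  obtains B where "\<And>n p. mono p \<Longrightarrow> range p \<subseteq> {a..b} \<Longrightarrow> variation_sum g n p \<le> B"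
proof -
  obtain \<delta> where \<delta>: "\<delta> > 0" and
    D: "\<And>n p x y. mono p \<Longrightarrow> range p \<subseteq> {x..y} \<Longrightarrow> a \<le> x \<Longrightarrow> y \<le> b \<Longrightarrow> y - x < \<delta> \<Longrightarrow> variation_sum g n p < 1"
    by (rule abs_continuous_variation_sum[OF ac zero_less_one]) blast
  have step: "variation_sum g n p \<le> real j"
    if "mono p" "range p \<subseteq> {a..b}" "range p \<subseteq> {a..a + real j * (\<delta> / 2)}" for n p j
    using that
  proof (induction j arbitrary: p)
    case 0
    then have "p i = a" for i by (auto simp: subset_iff)
    then show ?case by (simp add: variation_sum_def)
  next
    case (Suc j)
    define t where "t = a + real j * (\<delta> / 2)"
    have ta: "a \<le> t" using \<delta> by (simp add: t_def)
    have bd: "a \<le> p i" "p i \<le> b" "p i \<le> t + \<delta> / 2" for i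
      using range_subsetD[OF Suc.prems(2), of i] range_subsetD[OF Suc.prems(3), of i]
      by (auto simp: t_def algebra_simps add_divide_distrib)
    show ?case
    proof (cases "t \<le> b")
      case True
      have "variation_sum g n (\<lambda>i. min (p i) t) \<le> real j"
        using Suc.prems(1) bd ta by (intro Suc.IH) (auto simp: mono_min_max_const t_def min_le_iff_disj)
      moreover have "variation_sum g n (\<lambda>i. max (p i) t) < 1"
        using Suc.prems(1) bd ta True \<delta>
        by (intro D[of _ t "min b (t + \<delta> / 2)"]) (auto simp: mono_min_max_const)
      ultimately show ?thesis using variation_sum_split[of g n p t] by simp
    next
      case False
      then have "p i \<le> a + real j * (\<delta> / 2)" for i using bd(2)[of i] by (simp add: t_def)
      then have "variation_sum g n p \<le> real j" using Suc.prems bd(1) by (intro Suc.IH) auto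
      then show ?thesis by simp
    qed
  qed
  obtain k :: nat where "(b - a) / (\<delta> / 2) < real k" using reals_Archimedean2 by blast
  then have k: "b < a + real k * (\<delta> / 2)" using \<delta> by (simp add: field_simps)
  show thesis
  proof (rule that)
    fix n p assume "mono (p :: nat \<Rightarrow> real)" "range p \<subseteq> {a..b}"
    then show "variation_sum g n p \<le> real k" using k by (intro step) (auto simp: subset_iff intro: order_trans less_imp_le)
  qed
qed

definition variation_sums :: "(real \<Rightarrow> real) \<Rightarrow> real \<Rightarrow> real \<Rightarrow> real set" where
  "variation_sums g a x = {variation_sum g n p |n p. mono p \<and> range p \<subseteq> {a..x}}"

definition total_variation :: "(real \<Rightarrow> real) \<Rightarrow> real \<Rightarrow> real \<Rightarrow> real" where
  "total_variation g a x = Sup (variation_sums g a x)"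

context
  fixes g :: "real \<Rightarrow> real"
  assumes ac: "locally_abs_continuous g"
begin

lemma bdd_above_variation_sums: assumes "a < x" shows "bdd_above (variation_sums g a x)"
proof -
  obtain B where "\<And>n p. mono p \<Longrightarrow> range p \<subseteq> {a..x} \<Longrightarrow> variation_sum g n p \<le> B"
    by (rule variation_sum_bounded[of a x g]) (use ac assms in \<open>unfold locally_abs_continuous_def, blast+\<close>)
  then show ?thesis unfolding variation_sums_def by (intro bdd_aboveI[of _ B]) blast
qed

lemma variation_sum_le_total:
  assumes "mono p" "range p \<subseteq> {a..x}"
  shows "variation_sum g n p \<le> total_variation g a x"
proof -
  \<comment> \<open>Local absolute continuity speaks of nondegenerate intervals, so boundedness for
    \<open>x \<le> a\<close> is inherited from a longer interval.\<close>
  have "variation_sums g a x \<subseteq> variation_sums g a (max x (a + 1))"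
    unfolding variation_sums_def by fastforce
  then have "bdd_above (variation_sums g a x)"
    by (rule bdd_above_mono[rotated]) (simp add: bdd_above_variation_sums)
  then show ?thesis
    unfolding total_variation_def using assms by (intro cSup_upper) (auto simp: variation_sums_def)
qed

lemma total_variation_leI:
  assumes "a \<le> x" "\<And>n p. mono p \<Longrightarrow> range p \<subseteq> {a..x} \<Longrightarrow> variation_sum g n p \<le> B"
  shows "total_variation g a x \<le> B"
proof -
  have "variation_sum g 0 (\<lambda>_. a) \<in> variation_sums g a x"
    using assms(1) by (fastforce simp: variation_sums_def mono_def)
  then show ?thesis unfolding total_variation_def
    by (intro cSup_least) (auto simp: variation_sums_def intro: assms(2))
qed

text \<open>Appending the points \<open>x\<close> and \<open>y\<close> to a partition of [a, x]
  gives one of [a, y], whose last step adds |g y - g x|.\<close>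

lemma abs_diff_le_total_variation:
  assumes "a \<le> x" "x \<le> y"
  shows "\<bar>g y - g x\<bar> \<le> total_variation g a y - total_variation g a x"
proof -
  have "total_variation g a x \<le> total_variation g a y - \<bar>g y - g x\<bar>"
  proof (rule total_variation_leI[OF assms(1)])
    fix n and p :: "nat \<Rightarrow> real" assume p: "mono p" "range p \<subseteq> {a..x}"
    define q where "q i = (if i \<le> n then p i else if i = Suc n then x else y)" for i
    have bd: "a \<le> p i" "p i \<le> x" for i using p(2) by (auto simp: subset_iff)
    have "mono q"
      unfolding mono_def q_def using p(1) bd assms by (auto simp: monoD intro: order_trans)
    moreover have "range q \<subseteq> {a..y}" using bd order_trans[OF bd(2) assms(2)] assms by (auto simp: q_def)
    ultimately have "variation_sum g (Suc (Suc n)) q \<le> total_variation g a y"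
      by (rule variation_sum_le_total)
    moreover have "variation_sum g (Suc (Suc n)) q = variation_sum g n p + \<bar>g x - g (p n)\<bar> + \<bar>g y - g x\<bar>"
      by (simp add: variation_sum_def q_def)
    ultimately show "variation_sum g n p \<le> total_variation g a y - \<bar>g y - g x\<bar>" by linarith
  qed
  then show ?thesis by linarith
qed

text \<open>Truncated at \<open>x\<close>, a partition of [a, y] has a left part bounded by the
  variation up to \<open>x\<close> and a right part inside [x, y], which absolute continuity makes
  small.\<close>

lemma total_variation_continuity:
  assumes "a < b" "\<epsilon> > 0"
  obtains \<delta> where "\<delta> > 0"
    "\<And>x y. a \<le> x \<Longrightarrow> x \<le> y \<Longrightarrow> y \<le> b \<Longrightarrow> y - x < \<delta> \<Longrightarrow> total_variation g a y - total_variation g a x \<le> \<epsilon>"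
proof -
  obtain \<delta> where \<delta>: "\<delta> > 0" and
    D: "\<And>n p x y. mono p \<Longrightarrow> range p \<subseteq> {x..y} \<Longrightarrow> a \<le> x \<Longrightarrow> y \<le> b \<Longrightarrow> y - x < \<delta> \<Longrightarrow> variation_sum g n p < \<epsilon>"
    by (rule abs_continuous_variation_sum[of a b g \<epsilon>])
       (use ac assms in \<open>unfold locally_abs_continuous_def, blast+\<close>)
  show thesis
  proof (rule that[OF \<delta>])
    fix x y assume xy: "a \<le> x" "x \<le> y" "y \<le> b" "y - x < \<delta>"
    have "total_variation g a y \<le> total_variation g a x + \<epsilon>"
    proof (rule total_variation_leI)
      fix n and p :: "nat \<Rightarrow> real" assume p: "mono p" "range p \<subseteq> {a..y}"
      have bd: "a \<le> p i" "p i \<le> y" for i using p(2) by (auto simp: subset_iff)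
      have "variation_sum g n (\<lambda>i. min (p i) x) \<le> total_variation g a x"
        using p(1) bd xy by (intro variation_sum_le_total) (auto simp: mono_min_max_const min_le_iff_disj)
      moreover have "variation_sum g n (\<lambda>i. max (p i) x) < \<epsilon>"
        using p(1) bd xy by (intro D[of _ x y]) (auto simp: mono_min_max_const le_max_iff_disj)
      ultimately show "variation_sum g n p \<le> total_variation g a x + \<epsilon>"
        using variation_sum_split[of g n p x] by linarith
    qed (use xy in simp)
    then show "total_variation g a y - total_variation g a x \<le> \<epsilon>" by simp
  qed
qed

text \<open>\<open>max a z\<close> continues the variation by a constant to the left of
  \<open>a\<close>, giving a function on the whole line, as the differentiation theorem for monotone
  functions expects.\<close>

lemma continuous_total_variation: "continuous_on UNIV (\<lambda>z. total_variation g a (max a z))"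
  unfolding continuous_on_iff
proof (intro ballI allI impI)
  fix z \<epsilon> :: real assume "\<epsilon> > 0"
  define b where "b = max a z + 1"
  have b: "a < b" by (auto simp: b_def)
  obtain \<delta> where \<delta>: "\<delta> > 0" and D:
    "\<And>x y. a \<le> x \<Longrightarrow> x \<le> y \<Longrightarrow> y \<le> b \<Longrightarrow> y - x < \<delta> \<Longrightarrow> total_variation g a y - total_variation g a x \<le> \<epsilon> / 2"
    using total_variation_continuity[of a b "\<epsilon> / 2"] b \<open>\<epsilon> > 0\<close> by auto
  have mono: "a \<le> x \<Longrightarrow> x \<le> y \<Longrightarrow> total_variation g a x \<le> total_variation g a y" for x y
    using abs_diff_le_total_variation[of a x y] by linarith
  have "dist (total_variation g a (max a w)) (total_variation g a (max a z)) < \<epsilon>"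
    if "dist w z < min \<delta> 1" for w
  proof (cases "w \<le> z")
    case True
    then have "max a w \<le> max a z" "max a z \<le> b" "max a z - max a w < \<delta>"
      using that \<delta> by (auto simp: dist_real_def b_def max_def)
    then show ?thesis using D[of "max a w" "max a z"] mono[of "max a w" "max a z"] \<open>\<epsilon> > 0\<close>
      by (simp add: dist_real_def)
  next
    case False
    then have "max a z \<le> max a w" "max a w \<le> b" "max a w - max a z < \<delta>"
      using that \<delta> by (auto simp: dist_real_def b_def max_def)
    then show ?thesis using D[of "max a z" "max a w"] mono[of "max a z" "max a w"] \<open>\<epsilon> > 0\<close>
      by (simp add: dist_real_def)
  qed
  with \<delta> show "\<exists>d>0. \<forall>w\<in>UNIV. dist w z < d \<longrightarrow>
      dist (total_variation g a (max a w)) (total_variation g a (max a z)) < \<epsilon>"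
    by (intro exI[of _ "min \<delta> 1"]) auto
qed

text \<open>Increments of \<open>g\<close> are dominated by those of its variation function, which
  is continuous. The base point z - 1 leaves room to the left of \<open>z\<close>.\<close>

lemma locally_abs_continuous_isCont: "isCont g z"
proof -
  define a where "a = z - 1"
  let ?W = "\<lambda>z. total_variation g a (max a z)"
  have "(?W \<longlongrightarrow> ?W z) (at z)"
    using continuous_total_variation[of a] by (simp add: continuous_on_def)
  then have "((\<lambda>w. ?W w - ?W z) \<longlongrightarrow> ?W z - ?W z) (at z)" by (intro tendsto_intros)
  then have *: "((\<lambda>w. ?W w - ?W z) \<longlongrightarrow> 0) (at z)" by simp
  have "((\<lambda>w. g w - g z) \<longlongrightarrow> 0) (at z)"
  proof (rule Lim_null_comparison[OF _ tendsto_norm_zero[OF *]])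
    have "eventually (\<lambda>w. w \<in> {a<..}) (at z)"
      by (intro eventually_at_topological[THEN iffD2] exI[of _ "{a<..}"]) (auto simp: a_def)
    then show "\<forall>\<^sub>F w in at z. norm (g w - g z) \<le> norm (?W w - ?W z)"
    proof eventually_elim
      case (elim w)
      then show ?case
        using abs_diff_le_total_variation[of a w z] abs_diff_le_total_variation[of a z w]
        by (cases "w \<le> z") (auto simp: a_def max_def abs_minus_commute)
    qed
  qed
  then show ?thesis by (simp add: isCont_def LIM_zero_iff)
qed

lemma locally_abs_continuous_imp_continuous_on: "continuous_on S g"
  by (simp add: continuous_at_imp_continuous_on locally_abs_continuous_isCont)

text \<open>Jordan decomposition: on the half-line right of \<open>a\<close>, \<open>g\<close> is the difference of the continuous
  increasing functions \<open>W\<close> and \<open>W - g\<close>, where \<open>W\<close> is the variation of \<open>g\<close> from \<open>a\<close>.\<close>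

lemma AE_differentiable_abs_continuous: "AE x in lborel. g differentiable (at x)"
proof -
  have half: "AE x in lborel. a < x \<longrightarrow> g differentiable (at x)" for a
  proof -
    define W where "W z = total_variation g a (max a z)" for z
    define H where "H z = W z - g (max a z)" for z
    have contW: "continuous_on UNIV W" unfolding W_def by (rule continuous_total_variation)
    \<comment> \<open>Domination in absolute value is what makes both \<open>W\<close> and
      \<open>H\<close> increasing.\<close>
    have key: "\<bar>g (max a y) - g (max a x)\<bar> \<le> W y - W x" if "x \<le> y" for x y
      unfolding W_def using that by (intro abs_diff_le_total_variation) auto
    have monoW: "mono W" by (rule monoI) (use key in force)
    have monoH: "mono H" unfolding H_def by (rule monoI) (use key in \<open>force simp: abs_le_iff\<close>)
    have contH: "continuous_on UNIV H" unfolding H_def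
      by (intro continuous_intros contW continuous_on_compose2[OF locally_abs_continuous_imp_continuous_on[of UNIV]]) auto
    show ?thesis
      using AE_differentiable_mono_continuous[OF monoW contW] AE_differentiable_mono_continuous[OF monoH contH]
    proof eventually_elim
      case (elim x)
      show ?case
      proof
        assume "a < x"
        from elim obtain v w where "(W has_real_derivative v) (at x)" "(H has_real_derivative w) (at x)"
          by (auto simp: real_differentiable_def)
        then have "((\<lambda>z. W z - H z) has_real_derivative v - w) (at x)" by (rule DERIV_diff)
        then have "(g has_real_derivative v - w) (at x)"
          by (rule has_field_derivative_transform_within_open[of _ _ _ "{a<..}"]) (use \<open>a < x\<close> in \<open>auto simp: H_def\<close>)
        then show "g differentiable (at x)" by (auto simp: real_differentiable_def)
      qed
    qed
  qed
  have "AE x in lborel. \<forall>n::nat. - real n < x \<longrightarrow> g differentiable (at x)"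
    unfolding AE_all_countable using half by blast
  then show ?thesis
  proof eventually_elim
    case (elim x)
    obtain n where "- x < real n" using reals_Archimedean2 by blast
    then show ?case using elim[rule_format, of n] by linarith
  qed
qed

end

section \<open>The fundamental theorem of calculus\<close>

text \<open>At tags in the exceptional null set the gauge is an open set of small measure, and absolute
  continuity bounds the increments of \<open>g\<close> there; at the other tags the straddle lemma applies.\<close>

theorem fundamental_theorem_abs_continuous:
  fixes g g' :: "real \<Rightarrow> real"
  assumes ac: "abs_continuous_on_interval a b g" and ab: "a \<le> b"
    and N: "N \<in> null_sets lborel"
    and deriv: "\<And>x. x \<in> {a..b} - N \<Longrightarrow> (g has_real_derivative g' x) (at x)"
  shows "(g' has_integral g b - g a) {a..b}"
proof -
  \<comment> \<open>With value 0 on \<open>N\<close>, a tag in \<open>N\<close> leaves only the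
    increment of \<open>g\<close> as its error; changing the integrand on a null set does not affect
    the integral.\<close>
  define f where "f x = (if x \<in> N then 0 else g' x)" for x
  have "(f has_integral g b - g a) {a..b}"
    unfolding has_integral_real
  proof (intro allI impI)
    fix e0 :: real assume e0: "e0 > 0"
    \<comment> \<open>Tags outside \<open>N\<close> cost at most e (b - a) and tags in
      \<open>N\<close> less than \<open>e\<close>; together this is below e (b - a + 2) =
      \<open>e0\<close>.\<close>
    define e where "e = e0 / (b - a + 2)"
    have e: "e > 0" using e0 ab by (simp add: e_def)
    have "e * (b - a + 2) = e0" using ab by (simp add: e_def)
    then have ee: "e * (b - a) + e < e0" using e by (simp add: algebra_simps)
    have "\<exists>d>0. \<forall>y. \<bar>y - x\<bar> < d \<longrightarrow> \<bar>g y - g x - (y - x) * g' x\<bar> \<le> e * \<bar>y - x\<bar>"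
      if "x \<in> {a..b} - N" for x
      using deriv[OF that] e unfolding has_field_derivative_def has_derivative_at_alt
      by (auto simp: mult.commute)
    then obtain d where d: "\<And>x. x \<in> {a..b} - N \<Longrightarrow> d x > 0"
      "\<And>x y. x \<in> {a..b} - N \<Longrightarrow> \<bar>y - x\<bar> < d x \<Longrightarrow> \<bar>g y - g x - (y - x) * g' x\<bar> \<le> e * \<bar>y - x\<bar>"
      by metis
    obtain \<delta> where \<delta>: "\<delta> > 0" and
      D: "\<And>(I :: (real \<times> real set) set) u v. finite I \<Longrightarrow> (\<And>i. i \<in> I \<Longrightarrow> a \<le> u i \<and> u i < v i \<and> v i \<le> b) \<Longrightarrow>
       disjoint_family_on (\<lambda>i. {u i<..<v i}) I \<Longrightarrow> (\<Sum>i\<in>I. v i - u i) < \<delta> \<Longrightarrow>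
       (\<Sum>i\<in>I. \<bar>g (v i) - g (u i)\<bar>) < e"
      by (rule abs_continuous_indexed[OF ac e, where ?'i = "real \<times> real set"]) blast
    have Nb: "N \<in> sets borel" "emeasure lborel N = 0" using N by auto
    obtain U where U: "open U" "N \<subseteq> U" "emeasure lborel (U - N) < ennreal \<delta>"
      using outer_regular_lborel[OF Nb(1) \<delta>] by auto
    have "emeasure lborel U = emeasure lborel (N \<union> (U - N))" using U(2) by (metis Diff_partition)
    also have "\<dots> \<le> emeasure lborel N + emeasure lborel (U - N)"
      using U(1) Nb(1) by (intro emeasure_subadditive) auto
    finally have U\<delta>: "emeasure lborel U < ennreal \<delta>" using U(3) Nb(2) by simp
    define \<gamma> where "\<gamma> x = (if x \<in> N then U else if x \<in> {a..b} then ball x (d x) else UNIV)" for x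
    have "gauge \<gamma>"
      using U d(1) by (auto simp: gauge_def \<gamma>_def)
    moreover have "norm ((\<Sum>(x, K)\<in>p. measure lborel K *\<^sub>R f x) - (g b - g a)) < e0"
      if p: "p tagged_division_of {a..b}" and fine: "\<gamma> fine p" for p
    proof -
      have pD: "\<exists>u v. K = {u..v} \<and> u \<le> v \<and> a \<le> u \<and> v \<le> b \<and> x \<in> {u..v}" if "(x, K) \<in> p" for x K
      proof -
        have "x \<in> K" "K \<subseteq> {a..b}" "\<exists>u v. K = cbox u v"
          using p that by (auto simp: tagged_division_of_def tagged_partial_division_of_def)
        then show ?thesis by (metis atLeastAtMost_iff box_real(2) atLeastatMost_subset_iff order_trans)
      qed
      have finp: "finite p" using p by (rule tagged_division_of_finite)
      have sum1: "b - a = (\<Sum>(x, K)\<in>p. Sup K - Inf K)" and sum2: "g b - g a = (\<Sum>(x, K)\<in>p. g (Sup K) - g (Inf K))"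
        using additive_tagged_division_1[OF ab p, of "\<lambda>x. x"] additive_tagged_division_1[OF ab p, of g] by auto
      define err where "err = (\<lambda>(x, K). measure lborel K * f x - (g (Sup K) - g (Inf K)))"
      define q where "q = {(x, K). (x, K) \<in> p \<and> x \<in> N}"
      have qp: "q \<subseteq> p" by (auto simp: q_def)
      have good: "\<bar>err i\<bar> \<le> e * (Sup (snd i) - Inf (snd i))" if ipq: "i \<in> p - q" for i
      proof -
        obtain x K where i: "i = (x, K)" by (cases i)
        obtain u v where K: "K = {u..v}" "u \<le> v" "a \<le> u" "v \<le> b" "x \<in> {u..v}"
          using pD[of x K] ipq i by auto
        have xN: "x \<in> {a..b} - N" using ipq i K by (auto simp: q_def)
        have "K \<subseteq> \<gamma> x" using fineD[OF fine, of x K] ipq i by simp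
        then have "K \<subseteq> ball x (d x)" using xN by (simp add: \<gamma>_def)
        moreover have "u \<in> K" "v \<in> K" using K by auto
        ultimately have "u \<in> ball x (d x)" "v \<in> ball x (d x)" by blast+
        then have "\<bar>u - x\<bar> < d x" "\<bar>v - x\<bar> < d x" by (auto simp: dist_real_def)
        then have "\<bar>g u - g x - (u - x) * g' x\<bar> \<le> e * \<bar>u - x\<bar>" "\<bar>g v - g x - (v - x) * g' x\<bar> \<le> e * \<bar>v - x\<bar>"
          using d(2)[OF xN] by auto
        \<comment> \<open>The tag lies between \<open>u\<close> and \<open>v\<close>, so the two
          errors measured from it add up to at most e (v - u).\<close>
        moreover have "\<bar>u - x\<bar> = x - u" "\<bar>v - x\<bar> = v - x" using K by auto
        ultimately have "\<bar>(v - u) * g' x - (g v - g u)\<bar> \<le> e * (v - u)"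
          by (simp add: algebra_simps abs_le_iff)
        then show ?thesis using K xN by (simp add: err_def i f_def)
      qed
      have bad: "(\<Sum>i\<in>q. \<bar>err i\<bar>) < e"
      proof -
        \<comment> \<open>Degenerate pieces are set aside for the indexed form of absolute
          continuity; their increments are 0.\<close>
        define r where "r = {i \<in> q. Inf (snd i) < Sup (snd i)}"
        have rK: "snd i = {Inf (snd i)..Sup (snd i)} \<and> a \<le> Inf (snd i) \<and> Sup (snd i) \<le> b \<and> snd i \<subseteq> U" if "i \<in> q" for i
        proof -
          obtain x K where i: "i = (x, K)" by (cases i)
          have *: "(x, K) \<in> p" "x \<in> N" using that by (auto simp: i q_def)
          obtain u v where K: "K = {u..v}" "u \<le> v" "a \<le> u" "v \<le> b" using pD[OF *(1)] by blast
          have "K \<subseteq> U" using fineD[OF fine *(1)] *(2) by (simp add: \<gamma>_def)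
          then show ?thesis using K by (simp add: i)
        qed
        have finr: "finite r" using finp qp by (auto simp: r_def intro: finite_subset)
        have disj: "disjoint_family_on (\<lambda>i. {Inf (snd i)<..<Sup (snd i)}) r"
          unfolding disjoint_family_on_def
        proof (intro ballI impI)
          fix i j assume ij: "i \<in> r" "j \<in> r" "i \<noteq> j"
          have "interior (snd i) \<inter> interior (snd j) = {}"
            using p ij qp unfolding tagged_division_of_def tagged_partial_division_of_def r_def
            by (metis (no_types, lifting) mem_Collect_eq prod.collapse subsetD)
          moreover have "interior (snd i) = {Inf (snd i)<..<Sup (snd i)}" "interior (snd j) = {Inf (snd j)<..<Sup (snd j)}"
            using rK[of i] rK[of j] ij interior_atLeastAtMost_real by (metis (lifting) mem_Collect_eq r_def)+
          ultimately show "{Inf (snd i)<..<Sup (snd i)} \<inter> {Inf (snd j)<..<Sup (snd j)} = {}" by simp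
        qed
        have "(\<Sum>i\<in>r. \<bar>g (Sup (snd i)) - g (Inf (snd i))\<bar>) < e"
        proof (rule D[OF finr _ disj])
          show "a \<le> Inf (snd i) \<and> Inf (snd i) < Sup (snd i) \<and> Sup (snd i) \<le> b" if "i \<in> r" for i
            using that rK[of i] by (simp add: r_def)
          \<comment> \<open>The pieces have disjoint interiors inside \<open>U\<close>, so their
            total length is at most |U| < \<delta>.\<close>
          have "ennreal (\<Sum>i\<in>r. Sup (snd i) - Inf (snd i)) = (\<Sum>i\<in>r. emeasure lborel {Inf (snd i)<..<Sup (snd i)})"
            by (subst sum_ennreal[symmetric]) (auto simp: r_def intro!: sum.cong)
          also have "\<dots> = emeasure lborel (\<Union>i\<in>r. {Inf (snd i)<..<Sup (snd i)})"
            using finr disj by (intro sum_emeasure) auto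
          also have "\<dots> \<le> emeasure lborel U"
          proof (rule emeasure_mono)
            show "(\<Union>i\<in>r. {Inf (snd i)<..<Sup (snd i)}) \<subseteq> U"
            proof safe
              fix i x assume "i \<in> r" "x \<in> {Inf (snd i)<..<Sup (snd i)}"
              moreover from this have "x \<in> {Inf (snd i)..Sup (snd i)}" by auto
              ultimately show "x \<in> U" using rK[of i] by (auto simp: r_def)
            qed
          qed (use U in auto)
          finally have "ennreal (\<Sum>i\<in>r. Sup (snd i) - Inf (snd i)) < ennreal \<delta>" using U\<delta> by (rule le_less_trans)
          then show "(\<Sum>i\<in>r. Sup (snd i) - Inf (snd i)) < \<delta>"
            by (meson ennreal_leI leD not_le_imp_less)
        qed
        also have "(\<Sum>i\<in>r. \<bar>g (Sup (snd i)) - g (Inf (snd i))\<bar>) = (\<Sum>i\<in>q. \<bar>g (Sup (snd i)) - g (Inf (snd i))\<bar>)"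
        proof (rule sum.mono_neutral_left)
          show "\<forall>i\<in>q - r. \<bar>g (Sup (snd i)) - g (Inf (snd i))\<bar> = 0"
          proof
            fix i assume i: "i \<in> q - r"
            then obtain u v where "snd i = {u..v}" "u \<le> v" using pD[of "fst i" "snd i"] qp by auto
            then show "\<bar>g (Sup (snd i)) - g (Inf (snd i))\<bar> = 0" using i by (simp add: r_def)
          qed
        qed (use finp qp in \<open>auto simp: r_def intro: finite_subset\<close>)
        also have "\<dots> = (\<Sum>i\<in>q. \<bar>err i\<bar>)"
          by (intro sum.cong) (auto simp: err_def q_def f_def)
        finally show ?thesis .
      qed
      have "(\<Sum>(x, K)\<in>p. measure lborel K *\<^sub>R f x) - (g b - g a) = (\<Sum>i\<in>p. err i)"
        unfolding sum2 err_def by (simp add: sum_subtractf[symmetric] case_prod_unfold)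
      also have "\<bar>\<dots>\<bar> \<le> (\<Sum>i\<in>p. \<bar>err i\<bar>)" by (rule sum_abs)
      also have "\<dots> = (\<Sum>i\<in>p - q. \<bar>err i\<bar>) + (\<Sum>i\<in>q. \<bar>err i\<bar>)"
        by (rule sum.subset_diff[OF qp finp])
      also have "(\<Sum>i\<in>p - q. \<bar>err i\<bar>) \<le> (\<Sum>i\<in>p - q. e * (Sup (snd i) - Inf (snd i)))"
        by (intro sum_mono good)
      also have "\<dots> \<le> (\<Sum>i\<in>p. e * (Sup (snd i) - Inf (snd i)))"
      proof (intro sum_mono2 finp)
        fix i assume "i \<in> p - (p - q)"
        then obtain u v where "snd i = {u..v}" "u \<le> v" using pD[of "fst i" "snd i"] by auto
        then show "0 \<le> e * (Sup (snd i) - Inf (snd i))" using e by simp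
      qed auto
      also have "\<dots> = e * (b - a)"
        unfolding sum1 by (simp add: sum_distrib_left case_prod_unfold)
      finally show ?thesis using bad ee by simp
    qed
    ultimately show "\<exists>\<gamma>. gauge \<gamma> \<and> (\<forall>p. p tagged_division_of {a..b} \<and> \<gamma> fine p \<longrightarrow>
        norm ((\<Sum>(x, K)\<in>p. measure lborel K *\<^sub>R f x) - (g b - g a)) < e0)"
      by (intro exI[of _ \<gamma>] conjI allI impI) simp_all
  qed
  moreover have "negligible N" using N by (simp add: negligible_iff_null_sets null_sets_completionI)
  ultimately show ?thesis
    using has_integral_spike[of N "{a..b}" g' f "g b - g a"] by (simp add: f_def)
qed

section \<open>From the gauge integral to Lebesgue bounds\<close>

text \<open>A gauge integral need not converge absolutely. If the right side is infinite there is
  nothing to prove; otherwise the integrand is Lebesgue integrable and the two integrals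
  agree.\<close>

lemma nn_integral_FTC_bound:
  fixes g g' :: "real \<Rightarrow> real"
  assumes int: "(g' has_integral c) {a..b}" and [measurable]: "g' \<in> borel_measurable borel"
  shows "ennreal \<bar>c\<bar> \<le> (\<integral>\<^sup>+x. ennreal \<bar>g' x\<bar> * indicator {a..b} x \<partial>lborel)" (is "_ \<le> ?I")
proof (cases "?I = \<infinity>")
  case False
  define F where "F x = indicator {a..b} x * g' x" for x
  have [measurable]: "F \<in> borel_measurable borel" by (simp add: F_def[abs_def])
  have nF: "(\<integral>\<^sup>+x. ennreal (norm (F x)) \<partial>lborel) = ?I"
    by (intro nn_integral_cong) (auto simp: F_def indicator_def)
  have iF: "integrable lborel F"
    using False by (intro integrableI_bounded) (auto simp: nF less_top simp del: real_norm_def)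
  then have "(F has_integral (integral\<^sup>L lborel F)) UNIV"
    by (rule has_integral_integral_lborel)
  moreover have "(F has_integral c) UNIV"
  proof -
    have "F = (\<lambda>x. if x \<in> {a..b} then g' x else 0)" by (auto simp: F_def indicator_def)
    then show ?thesis using int by (simp only: has_integral_restrict_UNIV)
  qed
  ultimately have "c = integral\<^sup>L lborel F" by (rule has_integral_unique[rotated])
  then show ?thesis using integral_norm_bound_ennreal[OF iF] nF by simp
qed simp

text \<open>On a compact interval |g - k| is at most some \<open>B\<close>, so factoring the
  difference of squares multiplies increments by at most 2 B.\<close>

lemma abs_continuous_square:
  assumes ac: "locally_abs_continuous g"
  shows "locally_abs_continuous (\<lambda>x. (g x - k)\<^sup>2)"
  unfolding locally_abs_continuous_def abs_continuous_on_interval_def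
proof (intro allI impI)
  fix a b \<epsilon> :: real assume ab: "a < b" and \<epsilon>: "\<epsilon> > 0"
  have "compact ((\<lambda>x. g x - k) ` {a..b})"
    by (intro compact_continuous_image continuous_intros locally_abs_continuous_imp_continuous_on[OF ac]) auto
  then obtain B where B: "B > 0" "\<And>x. x \<in> {a..b} \<Longrightarrow> \<bar>g x - k\<bar> \<le> B"
    by (auto dest!: compact_imp_bounded simp: bounded_pos)
  have "abs_continuous_on_interval a b g" using ac ab by (simp add: locally_abs_continuous_def)
  moreover have "\<epsilon> / (2 * B) > 0" using \<epsilon> B by simp
  ultimately obtain \<delta> where \<delta>: "\<delta> > 0" and D: "\<forall>S :: (real \<times> real) set. finite S \<longrightarrow>
       (\<forall>(x, y)\<in>S. a \<le> x \<and> x \<le> y \<and> y \<le> b) \<longrightarrow>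
       pairwise (\<lambda>p q. disjnt {fst p<..<snd p} {fst q<..<snd q}) S \<longrightarrow>
       (\<Sum>(x, y)\<in>S. y - x) < \<delta> \<longrightarrow> (\<Sum>(x, y)\<in>S. \<bar>g y - g x\<bar>) < \<epsilon> / (2 * B)"
    unfolding abs_continuous_on_interval_def by blast
  show "\<exists>\<delta>>0. \<forall>S. finite S \<longrightarrow>
        (\<forall>(x, y)\<in>S. a \<le> x \<and> x \<le> y \<and> y \<le> b) \<longrightarrow>
        pairwise (\<lambda>p q. disjnt {fst p<..<snd p} {fst q<..<snd q}) S \<longrightarrow>
        (\<Sum>(x, y)\<in>S. y - x) < \<delta> \<longrightarrow> (\<Sum>(x, y)\<in>S. \<bar>(g y - k)\<^sup>2 - (g x - k)\<^sup>2\<bar>) < \<epsilon>"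
  proof (intro exI[of _ \<delta>] conjI allI impI \<delta>)
    fix S :: "(real \<times> real) set"
    assume S: "finite S" "\<forall>(x, y)\<in>S. a \<le> x \<and> x \<le> y \<and> y \<le> b"
      "pairwise (\<lambda>p q. disjnt {fst p<..<snd p} {fst q<..<snd q}) S" "(\<Sum>(x, y)\<in>S. y - x) < \<delta>"
    have "(\<Sum>(x, y)\<in>S. \<bar>(g y - k)\<^sup>2 - (g x - k)\<^sup>2\<bar>) \<le> (\<Sum>(x, y)\<in>S. (2 * B) * \<bar>g y - g x\<bar>)"
    proof (rule sum_mono, clarify)
      fix x y assume "(x, y) \<in> S"
      then have xy: "x \<in> {a..b}" "y \<in> {a..b}" using S(2) by auto
      have "\<bar>(g y - k)\<^sup>2 - (g x - k)\<^sup>2\<bar> = \<bar>(g y - k) + (g x - k)\<bar> * \<bar>g y - g x\<bar>"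
        by (simp add: abs_mult[symmetric] power2_eq_square algebra_simps)
      also have "\<dots> \<le> (2 * B) * \<bar>g y - g x\<bar>"
        using B(2)[OF xy(1)] B(2)[OF xy(2)] by (intro mult_right_mono) linarith+
      finally show "\<bar>(g y - k)\<^sup>2 - (g x - k)\<^sup>2\<bar> \<le> (2 * B) * \<bar>g y - g x\<bar>" .
    qed
    also have "\<dots> = (2 * B) * (\<Sum>(x, y)\<in>S. \<bar>g y - g x\<bar>)"
      by (simp add: sum_distrib_left case_prod_unfold)
    also have "\<dots> < (2 * B) * (\<epsilon> / (2 * B))"
      using D S B by (intro mult_strict_left_mono) auto
    finally show "(\<Sum>(x, y)\<in>S. \<bar>(g y - k)\<^sup>2 - (g x - k)\<^sup>2\<bar>) < \<epsilon>" using B by simp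
  qed
qed

text \<open>\<open>D\<close> is the limit of continuous difference quotients along 1 / (n + 1),
  which makes it Borel measurable, as Tonelli's theorem will require; on \<open>N\<close> nothing is
  claimed about its value.\<close>

lemma abs_continuous_borel_derivative:
  assumes ac: "locally_abs_continuous g"
  obtains D N where "D \<in> borel_measurable borel" "N \<in> null_sets lborel"
    "\<And>x. x \<notin> N \<Longrightarrow> (g has_real_derivative D x) (at x)"
proof -
  obtain N where N: "{x \<in> space lborel. \<not> g differentiable (at x)} \<subseteq> N" "emeasure lborel N = 0" "N \<in> sets lborel"
    using AE_differentiable_abs_continuous[OF ac] by (rule AE_E)
  define D where "D x = lim (\<lambda>n. (g (x + inverse (real (Suc n))) - g x) / inverse (real (Suc n)))" for x
  have [measurable]: "g \<in> borel_measurable borel"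
    by (intro borel_measurable_continuous_onI locally_abs_continuous_imp_continuous_on[OF ac])
  have "D \<in> borel_measurable borel" unfolding D_def[abs_def] by measurable
  moreover have "(g has_real_derivative D x) (at x)" if "x \<notin> N" for x
  proof -
    have "g differentiable (at x)" using N(1) that by auto
    then obtain d where d: "(g has_real_derivative d) (at x)" by (auto simp: real_differentiable_def)
    have "filterlim (\<lambda>n. inverse (real (Suc n))) (at 0) sequentially"
      using LIMSEQ_inverse_real_of_nat by (auto simp: filterlim_at)
    then have "(\<lambda>n. (g (x + inverse (real (Suc n))) - g x) / inverse (real (Suc n))) \<longlonglongrightarrow> d"
      using d unfolding DERIV_def by (rule filterlim_compose[rotated])
    then have "D x = d" unfolding D_def by (rule limI)
    then show ?thesis using d by simp
  qed
  ultimately show thesis using that null_setsI[OF N(2,3)] by blast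
qed

text \<open>The fundamental theorem is applied to the square, which vanishes at \<open>m\<close>;
  \<open>min\<close> and \<open>max\<close> treat both sides of \<open>m\<close> at once.\<close>

lemma abs_continuous_square_bound:
  assumes ac: "locally_abs_continuous g" and D[measurable]: "D \<in> borel_measurable borel"
    and N: "N \<in> null_sets lborel" and deriv: "\<And>x. x \<notin> N \<Longrightarrow> (g has_real_derivative D x) (at x)"
  shows "ennreal ((g x - g m)\<^sup>2) \<le>
    (\<integral>\<^sup>+t. ennreal (2 * \<bar>g t - g m\<bar> * \<bar>D t\<bar>) * indicator {min m x..max m x} t \<partial>lborel)"
proof -
  define G where "G t = (g t - g m)\<^sup>2" for t
  define G' where "G' t = 2 * (g t - g m) * D t" for t
  have [measurable]: "g \<in> borel_measurable borel"
    by (intro borel_measurable_continuous_onI locally_abs_continuous_imp_continuous_on[OF ac])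
  have G': "G' \<in> borel_measurable borel" unfolding G'_def[abs_def] by measurable
  have "abs_continuous_on_interval (min m x) (max m x) G" if "m \<noteq> x"
    using abs_continuous_square[OF ac, of "g m"] that unfolding locally_abs_continuous_def G_def[abs_def]
    by (simp add: min_def max_def)
  moreover have "(G has_real_derivative G' t) (at t)" if "t \<notin> N" for t
    unfolding G_def[abs_def] G'_def by (rule derivative_eq_intros deriv[OF that] refl)+ simp
  ultimately have "(G' has_integral G (max m x) - G (min m x)) {min m x..max m x}" if "m \<noteq> x"
    using that by (intro fundamental_theorem_abs_continuous[OF _ _ N]) auto
  then have int: "(G' has_integral G (max m x) - G (min m x)) {min m x..max m x}"
    by (cases "m = x") auto
  have "(g x - g m)\<^sup>2 = \<bar>G (max m x) - G (min m x)\<bar>"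
    by (simp add: G_def max_def min_def)
  then have "ennreal ((g x - g m)\<^sup>2) \<le> (\<integral>\<^sup>+t. ennreal \<bar>G' t\<bar> * indicator {min m x..max m x} t \<partial>lborel)"
    using nn_integral_FTC_bound[OF int G'] by simp
  also have "\<dots> = (\<integral>\<^sup>+t. ennreal (2 * \<bar>g t - g m\<bar> * \<bar>D t\<bar>) * indicator {min m x..max m x} t \<partial>lborel)"
    by (simp only: G'_def abs_mult abs_numeral)
  finally show ?thesis .
qed

lemma locally_Lipschitz_imp_abs_continuous:
  assumes "locally_Lipschitz g"
  shows "locally_abs_continuous g"
  unfolding locally_abs_continuous_def
proof (intro allI impI)
  fix a b :: real assume ab: "a < b"
  \<comment> \<open>\<open>local_lipschitz\<close> is a notion for time-dependent maps, so a dummy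
    time set {0} is supplied; compactness then yields one constant on [a, b].\<close>
  have "local_lipschitz {0::real} {a..b} (\<lambda>_. g)"
  proof (rule local_lipschitzI)
    fix t x :: real assume "x \<in> {a..b}"
    obtain r L where "r > 0" "L-lipschitz_on (cball x r) g"
      using assms unfolding locally_Lipschitz_def by blast
    then show "\<exists>u>0. \<exists>L. \<forall>t\<in>cball t u \<inter> {0}. L-lipschitz_on (cball x u \<inter> {a..b}) g"
      by (blast intro: lipschitz_on_subset)
  qed
  then obtain L where L: "L-lipschitz_on {a..b} g"
    by (rule local_lipschitz_compact_implies_lipschitz) auto
  have L0: "L \<ge> 0" using L by (rule lipschitz_on_nonneg)
  show "abs_continuous_on_interval a b g"
    unfolding abs_continuous_on_interval_def
  proof (intro allI impI)
    fix \<epsilon> :: real assume \<epsilon>: "\<epsilon> > 0"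
    show "\<exists>\<delta>>0. \<forall>S. finite S \<longrightarrow>
        (\<forall>(x, y)\<in>S. a \<le> x \<and> x \<le> y \<and> y \<le> b) \<longrightarrow>
        pairwise (\<lambda>p q. disjnt {fst p<..<snd p} {fst q<..<snd q}) S \<longrightarrow>
        (\<Sum>(x, y)\<in>S. y - x) < \<delta> \<longrightarrow> (\<Sum>(x, y)\<in>S. \<bar>g y - g x\<bar>) < \<epsilon>"
    \<comment> \<open>\<open>L + 1\<close> is positive even when L = 0.\<close>
    proof (intro exI[of _ "\<epsilon> / (L + 1)"] conjI allI impI)
      fix S :: "(real \<times> real) set"
      assume S: "finite S" "\<forall>(x, y)\<in>S. a \<le> x \<and> x \<le> y \<and> y \<le> b" "(\<Sum>(x, y)\<in>S. y - x) < \<epsilon> / (L + 1)"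
      have "(\<Sum>(x, y)\<in>S. \<bar>g y - g x\<bar>) \<le> (\<Sum>(x, y)\<in>S. (L + 1) * (y - x))"
      proof (rule sum_mono, clarify)
        fix x y assume "(x, y) \<in> S"
        then have xy: "a \<le> x" "x \<le> y" "y \<le> b" using S(2) by auto
        then have "\<bar>g y - g x\<bar> \<le> L * (y - x)"
          using lipschitz_onD[OF L, of y x] by (simp add: dist_real_def)
        then show "\<bar>g y - g x\<bar> \<le> (L + 1) * (y - x)" using xy by (simp add: algebra_simps)
      qed
      also have "\<dots> = (L + 1) * (\<Sum>(x, y)\<in>S. y - x)" by (simp add: sum_distrib_left case_prod_unfold)
      also have "\<dots> < (L + 1) * (\<epsilon> / (L + 1))" using S(3) L0 by (intro mult_strict_left_mono) auto
      finally show "(\<Sum>(x, y)\<in>S. \<bar>g y - g x\<bar>) < \<epsilon>" using L0 by simp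
    qed (use \<epsilon> L0 in simp)
  qed
qed

section \<open>The isoperimetric constant and the density\<close>

text \<open>The supremum is itself admissible, because multiplication by a constant commutes with
  suprema in \<open>ennreal\<close>.\<close>

lemma Is_mult_min_le_boundary_measure:
  assumes "A \<in> sets \<mu>"
  shows "Is \<mu> * min (emeasure \<mu> A) (1 - emeasure \<mu> A) \<le> boundary_measure \<mu> A"
proof -
  have "Is \<mu> * k = (SUP c\<in>{c. \<forall>A\<in>sets \<mu>. c * min (emeasure \<mu> A) (1 - emeasure \<mu> A) \<le> boundary_measure \<mu> A}. c * k)" for k
    unfolding Is_def by (subst SUP_mult_right_ennreal[symmetric]) simp
  then show ?thesis using assms by (auto intro!: SUP_least)
qed

locale positive_density_prob = prob_space \<mu> for \<mu> :: "real measure" +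
  fixes f :: "real \<Rightarrow> real"
  assumes f[measurable]: "f \<in> borel_measurable borel"
    and pos: "\<And>x. f x > 0"
    and \<mu>_eq: "\<mu> = density lborel (\<lambda>x. ennreal (f x))"
begin

lemma sets_\<mu>[measurable_cong, simp]: "sets \<mu> = sets borel" by (simp add: \<mu>_eq)
lemma space_\<mu>[simp]: "space \<mu> = UNIV" by (simp add: \<mu>_eq)
lemma not_density_nonpos[simp]: "\<not> f x \<le> 0" using pos[of x] by simp

lemma emeasure_\<mu>: "A \<in> sets borel \<Longrightarrow> emeasure \<mu> A = (\<integral>\<^sup>+x. ennreal (f x) * indicator A x \<partial>lborel)"
  by (subst \<mu>_eq) (simp add: emeasure_density)

lemma AE_\<mu>: "(AE x in \<mu>. P x) \<longleftrightarrow> (AE x in lborel. P x)"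
  by (subst \<mu>_eq, subst AE_density) (auto simp: pos)

lemma nn_integral_\<mu>: "h \<in> borel_measurable borel \<Longrightarrow> (\<integral>\<^sup>+x. h x \<partial>\<mu>) = (\<integral>\<^sup>+x. ennreal (f x) * h x \<partial>lborel)"
  by (subst \<mu>_eq) (simp add: nn_integral_density)

definition \<mu>_min :: "real \<Rightarrow> real" where "\<mu>_min x = min (measure \<mu> {..x}) (1 - measure \<mu> {..x})"

lemma borel_\<mu>_min[measurable]: "\<mu>_min \<in> borel_measurable borel"
proof -
  have "mono (\<lambda>x. measure \<mu> {..x})" by (intro monoI finite_measure_mono) auto
  then have [measurable]: "(\<lambda>x. measure \<mu> {..x}) \<in> borel_measurable borel" by (rule borel_measurable_mono)
  show ?thesis unfolding \<mu>_min_def[abs_def] by measurable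
qed

lemma \<mu>_min_nonneg: "0 \<le> \<mu>_min x" by (simp add: \<mu>_min_def)

lemma \<mu>_min_emeasure: "min (emeasure \<mu> {..x}) (1 - emeasure \<mu> {..x}) = ennreal (\<mu>_min x)"
proof -
  have "1 - emeasure \<mu> {..x} = ennreal (1 - measure \<mu> {..x})"
    by (simp add: emeasure_eq_measure ennreal_minus flip: ennreal_1)
  then show ?thesis by (simp add: emeasure_eq_measure \<mu>_min_def min_def ennreal_le_iff)
qed

text \<open>Enlarging \<open>{..x}\<close> by \<open>h\<close> adds at most
  \<open>{x..x + h}\<close>, so a liminf above \<open>r\<close> gives these intervals measure at
  least r h for all small \<open>h\<close>. They form the Vitali cover.\<close>

lemma half_line_boundary_cover:
  assumes r: "ennreal r < Is \<mu> * ennreal (\<mu>_min x)" "r \<ge> 0" and d: "d > 0"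
  shows "\<exists>u v. u \<le> x \<and> x \<le> v \<and> u < v \<and> v - u < d \<and> ennreal (r * (v - u)) \<le> emeasure \<mu> {u..v}"
proof -
  have "ennreal r < boundary_measure \<mu> {..x}"
    using r(1) Is_mult_min_le_boundary_measure[of "{..x}" \<mu>] by (simp add: \<mu>_min_emeasure)
  then have "eventually (\<lambda>h. ennreal r < (emeasure \<mu> (enlargement {..x} h) - emeasure \<mu> {..x}) / ennreal h) (at_right 0)"
    unfolding boundary_measure_def by (rule less_LiminfD)
  moreover have "eventually (\<lambda>h. h \<in> {0<..<d}) (at_right (0::real))"
    using d by (rule eventually_at_right_real)
  ultimately have "eventually (\<lambda>h. h \<in> {0<..<d} \<and> ennreal r < (emeasure \<mu> (enlargement {..x} h) - emeasure \<mu> {..x}) / ennreal h) (at_right 0)"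
    by eventually_elim simp
  then obtain h where h: "0 < h" "h < d" "ennreal r < (emeasure \<mu> (enlargement {..x} h) - emeasure \<mu> {..x}) / ennreal h"
    using eventually_happens[of _ "at_right (0::real)"] by (auto simp: trivial_limit_at_right_real)
  have "enlargement {..x} h \<subseteq> {..x} \<union> {x..x + h}"
    unfolding enlargement_def by auto
  then have "emeasure \<mu> (enlargement {..x} h) \<le> emeasure \<mu> ({..x} \<union> {x..x + h})"
    by (intro emeasure_mono) auto
  also have "\<dots> \<le> emeasure \<mu> {..x} + emeasure \<mu> {x..x + h}"
    by (intro emeasure_subadditive) auto
  finally have le: "emeasure \<mu> (enlargement {..x} h) - emeasure \<mu> {..x} \<le> emeasure \<mu> {x..x + h}"
    by (simp add: ennreal_minus_le_iff add.commute)
  have "ennreal r * ennreal h \<le> (emeasure \<mu> (enlargement {..x} h) - emeasure \<mu> {..x}) / ennreal h * ennreal h"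
    using h(3) by (intro mult_right_mono) auto
  also have "\<dots> = emeasure \<mu> (enlargement {..x} h) - emeasure \<mu> {..x}"
    using h(1) by (simp add: divide_ennreal_def mult.assoc inverse_ennreal ennreal_mult'[symmetric])
  also note le
  finally show ?thesis using h r(2) by (intro exI[of _ x] exI[of _ "x + h"]) (auto simp: ennreal_mult)
qed

text \<open>Covering gives r |E| at most \<mu>(U) for every open U containing the bad set
  \<open>E\<close>, hence at most \<mu>(E) by outer regularity. But \<mu>(E) is the integral over
  \<open>E\<close> of \<open>f\<close>, which is below \<open>r\<close> there, so |E| = 0.\<close>

lemma isoperimetric_gap_null:
  fixes r s :: real
  assumes "r \<ge> 0"
  shows "AE x in lborel. \<not> (f x < r \<and> ennreal r < Is \<mu> * ennreal (\<mu>_min x) \<and> \<bar>x\<bar> < s)"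
proof -
  define E where "E = {x. f x < r \<and> ennreal r < Is \<mu> * ennreal (\<mu>_min x) \<and> \<bar>x\<bar> < s}"
  have E[measurable]: "E \<in> sets borel" unfolding E_def by measurable
  have "ennreal r * emeasure lborel E \<le> emeasure \<mu> U" if "open U" "E \<subseteq> U" for U
  proof (rule vitali_upper_measure_bound[OF sets_\<mu> E that assms])
    fix x d :: real assume "x \<in> E" "d > 0"
    then have "ennreal r < Is \<mu> * ennreal (\<mu>_min x)" by (simp add: E_def)
    then show "\<exists>u v. u \<le> x \<and> x \<le> v \<and> u < v \<and> v - u < d \<and> ennreal (r * (v - u)) \<le> emeasure \<mu> {u..v}"
      using assms \<open>d > 0\<close> by (rule half_line_boundary_cover)
  qed
  then have "ennreal r * emeasure lborel E \<le> (INF U\<in>{U. E \<subseteq> U \<and> open U}. emeasure \<mu> U)"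
    by (intro INF_greatest) auto
  also have "\<dots> = emeasure \<mu> E"
    by (rule outer_regular[symmetric]) (auto simp: emeasure_eq_measure)
  finally have le: "ennreal r * emeasure lborel E \<le> emeasure \<mu> E" .
  have "emeasure \<mu> E + (\<integral>\<^sup>+x. ennreal (r - f x) * indicator E x \<partial>lborel) =
      (\<integral>\<^sup>+x. ennreal (f x) * indicator E x + ennreal (r - f x) * indicator E x \<partial>lborel)"
    by (subst nn_integral_add) (auto simp: emeasure_\<mu>)
  also have "\<dots> = (\<integral>\<^sup>+x. ennreal r * indicator E x \<partial>lborel)"
    using pos by (intro nn_integral_cong)
      (auto simp: E_def indicator_def ennreal_plus[symmetric] less_imp_le simp del: ennreal_plus)
  also have "\<dots> = ennreal r * emeasure lborel E"
    by (simp add: nn_integral_cmult_indicator)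
  finally have "emeasure \<mu> E + (\<integral>\<^sup>+x. ennreal (r - f x) * indicator E x \<partial>lborel) \<le> emeasure \<mu> E + 0"
    using le by simp
  then have "(\<integral>\<^sup>+x. ennreal (r - f x) * indicator E x \<partial>lborel) = 0"
    by (subst (asm) ennreal_add_left_cancel_le) auto
  then have "AE x in lborel. ennreal (r - f x) * indicator E x = 0"
    by (subst (asm) nn_integral_0_iff_AE) auto
  then show ?thesis
    by eventually_elim (auto simp: E_def indicator_def ennreal_eq_0_iff split: if_splits)
qed

text \<open>A failure at \<open>x\<close> leaves room for a rational between the two sides, so
  \<open>x\<close> falls into one of countably many null sets.\<close>

lemma isoperimetric_density_bound:
  "AE x in lborel. Is \<mu> * ennreal (\<mu>_min x) \<le> ennreal (f x)"
proof -
  have "AE x in lborel. \<forall>r::rat. \<forall>n::nat. r \<ge> 0 \<longrightarrow> \<not> (f x < real_of_rat r \<and>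
      ennreal (real_of_rat r) < Is \<mu> * ennreal (\<mu>_min x) \<and> \<bar>x\<bar> < real n)"
    unfolding AE_all_countable
  proof (intro allI)
    fix r :: rat and n :: nat
    show "AE x in lborel. r \<ge> 0 \<longrightarrow> \<not> (f x < real_of_rat r \<and>
      ennreal (real_of_rat r) < Is \<mu> * ennreal (\<mu>_min x) \<and> \<bar>x\<bar> < real n)"
      using isoperimetric_gap_null[of "real_of_rat r" "real n"] by (cases "r \<ge> 0") auto
  qed
  then show ?thesis
  proof eventually_elim
    case (elim x)
    show ?case
    proof (rule ccontr)
      assume "\<not> ?thesis"
      then have "ennreal (f x) < Is \<mu> * ennreal (\<mu>_min x)" by simp
      then obtain r :: rat where r: "ennreal (f x) < ennreal (real_of_rat r)" "ennreal (real_of_rat r) < Is \<mu> * ennreal (\<mu>_min x)"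
        using ennreal_rat_dense by blast
      have "f x < real_of_rat r" using r(1) by (meson ennreal_leI leD not_le_imp_less)
      moreover from this have "r \<ge> 0" using pos[of x] by (metis less_trans less_imp_le zero_less_of_rat_iff)
      moreover obtain n :: nat where "\<bar>x\<bar> < real n" using reals_Archimedean2 by blast
      ultimately show False using elim r(2) by blast
    qed
  qed
qed

text \<open>Each tail contains an interval of length 1, which is not null for a positive density.
  Strict positivity is what excludes an infinite \<open>Is \<mu>\<close>, as infinity times 0 would
  be 0.\<close>

lemma \<mu>_min_pos: "0 < \<mu>_min t"
proof -
  have pos_meas: "measure \<mu> A > 0" if A: "A \<in> sets borel" "{c..c + 1} \<subseteq> A" for A c
  proof (rule ccontr)
    assume "\<not> measure \<mu> A > 0"
    then have "emeasure \<mu> A = 0" by (simp add: emeasure_eq_measure zero_less_measure_iff)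
    then have "A \<in> null_sets (density lborel (\<lambda>x. ennreal (f x)))" using A by (subst \<mu>_eq[symmetric]) (simp add: null_sets_def)
    then have "AE x in lborel. x \<in> A \<longrightarrow> ennreal (f x) = 0"
      by (subst (asm) null_sets_density_iff) auto
    then have "AE x in lborel. x \<notin> A"
      by eventually_elim (auto simp: ennreal_eq_0_iff)
    then have "A \<in> null_sets lborel" using A by (simp add: AE_iff_null_sets)
    then have "emeasure lborel {c..c + 1} \<le> 0"
      using A emeasure_mono[of "{c..c + 1}" A lborel] by (simp add: null_sets_def)
    then show False by simp
  qed
  have "measure \<mu> {..t} > 0" by (rule pos_meas[of _ "t - 1"]) auto
  moreover have "measure \<mu> {t<..} > 0" by (rule pos_meas[of _ "t + 1"]) auto
  moreover have "measure \<mu> {t<..} = 1 - measure \<mu> {..t}"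
    using prob_compl[of "{..t}"] by (simp add: Compl_eq_Diff_UNIV[symmetric])
  ultimately show ?thesis by (simp add: \<mu>_min_def)
qed

lemma Is_finite: "Is \<mu> < \<infinity>"
proof (rule ccontr)
  assume "\<not> Is \<mu> < \<infinity>"
  then have inf: "Is \<mu> = \<top>" by (simp add: less_top[symmetric])
  have "AE x in lborel. x \<notin> (UNIV :: real set)"
    using isoperimetric_density_bound
  proof eventually_elim
    case (elim x)
    have "\<not> \<mu>_min x \<le> 0" using \<mu>_min_pos[of x] by simp
    then show ?case using elim by (simp add: inf ennreal_top_mult ennreal_eq_0_iff top_unique)
  qed
  then have "(UNIV :: real set) \<in> null_sets lborel" by (subst AE_iff_null_sets) auto
  then show False by (simp add: null_sets_def)
qed

section \<open>The Hardy-type inequality\<close>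

text \<open>The median is the infimum of the points where F is at least 1/2. Describing only t
  \<noteq> m suffices, because {m} is null.\<close>

lemma median_exists:
  obtains m where "\<And>t. m < t \<Longrightarrow> 1 / 2 \<le> measure \<mu> {..t}" "\<And>t. t < m \<Longrightarrow> measure \<mu> {..t} \<le> 1 / 2"
proof -
  interpret real_distribution \<mu> by unfold_locales simp_all
  define S where "S = {t. 1 / 2 \<le> measure \<mu> {..t}}"
  have mono: "s \<le> t \<Longrightarrow> measure \<mu> {..s} \<le> measure \<mu> {..t}" for s t by (intro finite_measure_mono) auto
  have "eventually (\<lambda>t. 1 / 2 < cdf \<mu> t) at_top"
    using cdf_lim_at_top_prob by (rule order_tendstoD) simp
  then obtain t where "1 / 2 < cdf \<mu> t" using eventually_happens by (metis trivial_limit_at_top_linorder)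
  then have ne: "S \<noteq> {}" by (auto simp: S_def cdf_def intro: less_imp_le)
  have "eventually (\<lambda>t. cdf \<mu> t < 1 / 2) at_bot"
    using cdf_lim_at_bot by (rule order_tendstoD) simp
  then obtain b where b: "cdf \<mu> b < 1 / 2" using eventually_happens by (metis trivial_limit_at_bot_linorder)
  have bdd: "bdd_below S"
  proof (rule bdd_belowI[of _ b])
    fix t assume "t \<in> S"
    then show "b \<le> t" using b mono[of t b] by (cases "b \<le> t") (auto simp: S_def cdf_def)
  qed
  show thesis
  proof (rule that[of "Inf S"])
    fix t assume "Inf S < t"
    then obtain s where "s \<in> S" "s < t" using ne cInf_lessD by blast
    then show "1 / 2 \<le> measure \<mu> {..t}" using mono[of s t] by (simp add: S_def)
  next
    fix t assume "t < Inf S"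
    then have "t \<notin> S" using bdd cInf_lower by (meson leD)
    then show "measure \<mu> {..t} \<le> 1 / 2" by (simp add: S_def)
  qed
qed

text \<open>For t > m the set is \<open>{t..}\<close>, and F(t) \<ge> 1/2 makes it the smaller tail;
  for t < m it is \<open>{..t}\<close>, symmetrically.\<close>

lemma emeasure_tail_le_\<mu>_min:
  assumes m: "\<And>t. m < t \<Longrightarrow> 1 / 2 \<le> measure \<mu> {..t}" "\<And>t. t < m \<Longrightarrow> measure \<mu> {..t} \<le> 1 / 2"
    and t: "t \<noteq> m"
  shows "emeasure \<mu> {x. min m x \<le> t \<and> t \<le> max m x} \<le> ennreal (\<mu>_min t)"
proof (cases "m < t")
  case True
  \<comment> \<open>The set contains \<open>t\<close> itself, a point of measure 0 because \<mu> has
    a density.\<close>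
  have "AE x in \<mu>. x \<notin> {t}" using AE_\<mu> AE_lborel_singleton[of t] by simp
  then have "{t} \<in> null_sets \<mu>" by (subst AE_iff_null_sets) auto
  then have "emeasure \<mu> {t} = 0" by (rule null_setsD1)
  have "emeasure \<mu> {x. min m x \<le> t \<and> t \<le> max m x} \<le> emeasure \<mu> ({t} \<union> {t<..})"
    using True by (intro emeasure_mono) (auto simp: min_def max_def split: if_splits)
  also have "\<dots> \<le> emeasure \<mu> {t} + emeasure \<mu> {t<..}" by (intro emeasure_subadditive) auto
  also have "\<dots> = ennreal (measure \<mu> {t<..})" using \<open>emeasure \<mu> {t} = 0\<close> by (simp add: emeasure_eq_measure)
  also have "measure \<mu> {t<..} = 1 - measure \<mu> {..t}"
    using prob_compl[of "{..t}"] by (simp add: Compl_eq_Diff_UNIV[symmetric])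
  also have "\<dots> = \<mu>_min t" using m(1)[OF True] by (simp add: \<mu>_min_def)
  finally show ?thesis .
next
  case False
  then have lt: "t < m" using t by simp
  have "emeasure \<mu> {x. min m x \<le> t \<and> t \<le> max m x} \<le> emeasure \<mu> {..t}"
    using lt by (intro emeasure_mono) (auto simp: min_def max_def split: if_splits)
  also have "\<dots> = ennreal (\<mu>_min t)" using m(2)[OF lt] by (simp add: \<mu>_min_def emeasure_eq_measure)
  finally show ?thesis .
qed

text \<open>Tonelli: integrating \<open>(g x - g m)\<^sup>2 \<le> 2 \<integral> \<bar>g - g m\<bar> \<bar>g'\<bar>\<close>, taken between the median \<open>m\<close> and \<open>x\<close>,
  with respect to \<open>\<mu>\<close> produces the smaller tail as a weight.\<close>

lemma median_square_bound:
  assumes ac: "locally_abs_continuous g" and D[measurable]: "D \<in> borel_measurable borel"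
    and N: "N \<in> null_sets lborel" and deriv: "\<And>x. x \<notin> N \<Longrightarrow> (g has_real_derivative D x) (at x)"
    and m: "\<And>t. m < t \<Longrightarrow> 1 / 2 \<le> measure \<mu> {..t}" "\<And>t. t < m \<Longrightarrow> measure \<mu> {..t} \<le> 1 / 2"
  shows "(\<integral>\<^sup>+x. ennreal ((g x - g m)\<^sup>2) \<partial>\<mu>) \<le>
    (\<integral>\<^sup>+t. ennreal (2 * \<bar>g t - g m\<bar> * \<bar>D t\<bar>) * ennreal (\<mu>_min t) \<partial>lborel)"
proof -
  have g[measurable]: "g \<in> borel_measurable borel"
    by (intro borel_measurable_continuous_onI locally_abs_continuous_imp_continuous_on[OF ac])
  interpret pair_sigma_finite \<mu> lborel by unfold_locales
  define \<phi> where "\<phi> t = ennreal (2 * \<bar>g t - g m\<bar> * \<bar>D t\<bar>)" for t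
  have [measurable]: "\<phi> \<in> borel_measurable borel" unfolding \<phi>_def[abs_def] by measurable
  have "(\<integral>\<^sup>+x. ennreal ((g x - g m)\<^sup>2) \<partial>\<mu>) \<le> (\<integral>\<^sup>+x. (\<integral>\<^sup>+t. \<phi> t * indicator {min m x..max m x} t \<partial>lborel) \<partial>\<mu>)"
    unfolding \<phi>_def by (intro nn_integral_mono abs_continuous_square_bound[OF ac D N deriv])
  \<comment> \<open>The conditional exhibits the integrand as jointly measurable in \<open>x\<close>
    and \<open>t\<close>, as the exchange requires.\<close>
  also have "\<dots> = (\<integral>\<^sup>+x. (\<integral>\<^sup>+t. (if min m x \<le> t \<and> t \<le> max m x then \<phi> t else 0) \<partial>lborel) \<partial>\<mu>)"
    by (intro nn_integral_cong) (auto simp: indicator_def)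
  also have "\<dots> = (\<integral>\<^sup>+t. (\<integral>\<^sup>+x. (if min m x \<le> t \<and> t \<le> max m x then \<phi> t else 0) \<partial>\<mu>) \<partial>lborel)"
    by (rule Fubini'[symmetric]) measurable
  also have "\<dots> = (\<integral>\<^sup>+t. \<phi> t * emeasure \<mu> {x. min m x \<le> t \<and> t \<le> max m x} \<partial>lborel)"
  proof (intro nn_integral_cong)
    fix t
    have "(\<integral>\<^sup>+x. (if min m x \<le> t \<and> t \<le> max m x then \<phi> t else 0) \<partial>\<mu>) =
      (\<integral>\<^sup>+x. \<phi> t * indicator {x. min m x \<le> t \<and> t \<le> max m x} x \<partial>\<mu>)"
      by (intro nn_integral_cong) (auto simp: indicator_def)
    also have "\<dots> = \<phi> t * emeasure \<mu> {x. min m x \<le> t \<and> t \<le> max m x}"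
      by (intro nn_integral_cmult_indicator) simp
    finally show "(\<integral>\<^sup>+x. (if min m x \<le> t \<and> t \<le> max m x then \<phi> t else 0) \<partial>\<mu>) =
      \<phi> t * emeasure \<mu> {x. min m x \<le> t \<and> t \<le> max m x}" .
  qed
  also have "\<dots> \<le> (\<integral>\<^sup>+t. \<phi> t * ennreal (\<mu>_min t) \<partial>lborel)"
  proof (rule nn_integral_mono_AE)
    show "AE t in lborel. \<phi> t * emeasure \<mu> {x. min m x \<le> t \<and> t \<le> max m x} \<le> \<phi> t * ennreal (\<mu>_min t)"
      using AE_lborel_singleton[of m]
      by eventually_elim (intro mult_left_mono emeasure_tail_le_\<mu>_min[OF m], auto)
  qed
  finally show ?thesis by (simp add: \<phi>_def)
qed

section \<open>Passage to the variance and to the Poincare constant\<close>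

text \<open>Expanding the square shows that the integral of (g - k)^2 exceeds the variance by (mean
  - k)^2. The finiteness claim is what permits the absorption later.\<close>

lemma Var_le_nn_integral:
  assumes "in_L2 \<mu> g"
  shows "ennreal (Var \<mu> g) \<le> (\<integral>\<^sup>+x. ennreal ((g x - k)\<^sup>2) \<partial>\<mu>)"
    and "(\<integral>\<^sup>+x. ennreal ((g x - k)\<^sup>2) \<partial>\<mu>) < \<infinity>"
proof -
  have g[measurable]: "g \<in> borel_measurable \<mu>" and g2: "integrable \<mu> (\<lambda>x. (g x)\<^sup>2)"
    using assms by (auto simp: in_L2_def)
  have ig: "integrable \<mu> g" using square_integrable_imp_integrable[OF g g2] .
  have sq: "(g x - c)\<^sup>2 = (g x)\<^sup>2 - 2 * c * g x + c\<^sup>2" for x c by (simp add: power2_eq_square algebra_simps)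
  have int: "integrable \<mu> (\<lambda>x. (g x - c)\<^sup>2)" for c
    unfolding sq using ig g2 by (intro Bochner_Integration.integrable_add Bochner_Integration.integrable_diff) auto
  have val: "(\<integral>x. (g x - c)\<^sup>2 \<partial>\<mu>) = (\<integral>x. (g x)\<^sup>2 \<partial>\<mu>) - 2 * c * (\<integral>x. g x \<partial>\<mu>) + c\<^sup>2" for c
    unfolding sq using ig g2 prob_space by (simp add: Bochner_Integration.integral_add Bochner_Integration.integral_diff)
  have "Var \<mu> g = (\<integral>x. (g x - k)\<^sup>2 \<partial>\<mu>) - ((\<integral>x. g x \<partial>\<mu>) - k)\<^sup>2"
    unfolding Var_def val by (simp add: power2_eq_square algebra_simps)
  then have "Var \<mu> g \<le> (\<integral>x. (g x - k)\<^sup>2 \<partial>\<mu>)" by simp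
  moreover have *: "(\<integral>\<^sup>+x. ennreal ((g x - k)\<^sup>2) \<partial>\<mu>) = ennreal (\<integral>x. (g x - k)\<^sup>2 \<partial>\<mu>)"
    by (intro nn_integral_eq_integral int) auto
  ultimately show "ennreal (Var \<mu> g) \<le> (\<integral>\<^sup>+x. ennreal ((g x - k)\<^sup>2) \<partial>\<mu>)" by (simp add: ennreal_leI)
  show "(\<integral>\<^sup>+x. ennreal ((g x - k)\<^sup>2) \<partial>\<mu>) < \<infinity>" by (simp add: *)
qed

lemma deriv_norm_sq_eq:
  assumes D[measurable]: "D \<in> borel_measurable borel"
    and N: "N \<in> null_sets lborel" and deriv: "\<And>x. x \<notin> N \<Longrightarrow> (g has_real_derivative D x) (at x)"
  shows "deriv_norm_sq \<mu> g = (\<integral>\<^sup>+x. ennreal (f x) * ennreal ((D x)\<^sup>2) \<partial>lborel)"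
proof -
  have "deriv_norm_sq \<mu> g = (\<integral>\<^sup>+x. ennreal ((D x)\<^sup>2) \<partial>\<mu>)"
    unfolding deriv_norm_sq_def
  proof (rule nn_integral_cong_AE)
    show "AE x in \<mu>. ennreal ((deriv g x)\<^sup>2) = ennreal ((D x)\<^sup>2)"
      unfolding AE_\<mu> using AE_not_in[OF N] by eventually_elim (simp add: DERIV_imp_deriv[OF deriv])
  qed
  then show ?thesis by (simp add: nn_integral_\<mu>)
qed

text \<open>Since f > 0, a zero norm means D = 0 almost everywhere, and the right side of the median
  bound vanishes. This settles the form infinity times 0 that arises when \<open>Is \<mu>\<close> is
  0.\<close>

lemma Var_zero_if_deriv_norm_sq_zero:
  assumes g2: "in_L2 \<mu> g" and ac: "locally_abs_continuous g" and zero: "deriv_norm_sq \<mu> g = 0"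
  shows "ennreal (Var \<mu> g) = 0"
proof -
  obtain m where m: "\<And>t. m < t \<Longrightarrow> 1 / 2 \<le> measure \<mu> {..t}" "\<And>t. t < m \<Longrightarrow> measure \<mu> {..t} \<le> 1 / 2"
    using median_exists by blast
  obtain D N where D[measurable]: "D \<in> borel_measurable borel" and N: "N \<in> null_sets lborel"
    and deriv: "\<And>x. x \<notin> N \<Longrightarrow> (g has_real_derivative D x) (at x)"
    using abs_continuous_borel_derivative[OF ac] by blast
  have "(\<integral>\<^sup>+x. ennreal (f x) * ennreal ((D x)\<^sup>2) \<partial>lborel) = 0"
    using zero deriv_norm_sq_eq[OF D N deriv] by simp
  then have "AE x in lborel. ennreal (f x) * ennreal ((D x)\<^sup>2) = 0"
    by (subst (asm) nn_integral_0_iff_AE) auto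
  then have "AE x in lborel. D x = 0"
    by eventually_elim (auto simp: ennreal_eq_0_iff)
  then have "AE t in lborel. ennreal (2 * \<bar>g t - g m\<bar> * \<bar>D t\<bar>) * ennreal (\<mu>_min t) = 0"
    by eventually_elim simp
  then have "(\<integral>\<^sup>+t. ennreal (2 * \<bar>g t - g m\<bar> * \<bar>D t\<bar>) * ennreal (\<mu>_min t) \<partial>lborel) = (\<integral>\<^sup>+t. 0 \<partial>(lborel :: real measure))"
    by (rule nn_integral_cong_AE)
  moreover have "(\<integral>\<^sup>+x. ennreal ((g x - g m)\<^sup>2) \<partial>\<mu>) \<le>
      (\<integral>\<^sup>+t. ennreal (2 * \<bar>g t - g m\<bar> * \<bar>D t\<bar>) * ennreal (\<mu>_min t) \<partial>lborel)"
    by (rule median_square_bound[OF ac D N deriv m])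
  ultimately have "(\<integral>\<^sup>+x. ennreal ((g x - g m)\<^sup>2) \<partial>\<mu>) \<le> 0" by simp
  then show ?thesis using Var_le_nn_integral(1)[OF g2, of "g m"] by (meson le_zero_eq order_trans)
qed

lemma Var_le_Is_positive:
  assumes g2: "in_L2 \<mu> g" and ac: "locally_abs_continuous g" and c: "Is \<mu> = ennreal c" "c > 0"
  shows "ennreal (Var \<mu> g) \<le> ennreal (4 / c\<^sup>2) * deriv_norm_sq \<mu> g"
proof -
  obtain m where m: "\<And>t. m < t \<Longrightarrow> 1 / 2 \<le> measure \<mu> {..t}" "\<And>t. t < m \<Longrightarrow> measure \<mu> {..t} \<le> 1 / 2"
    using median_exists by blast
  obtain D N where D[measurable]: "D \<in> borel_measurable borel" and N: "N \<in> null_sets lborel"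
    and deriv: "\<And>x. x \<notin> N \<Longrightarrow> (g has_real_derivative D x) (at x)"
    using abs_continuous_borel_derivative[OF ac] by blast
  have g[measurable]: "g \<in> borel_measurable borel"
    by (intro borel_measurable_continuous_onI locally_abs_continuous_imp_continuous_on[OF ac])
  define J where "J = (\<integral>\<^sup>+x. ennreal ((g x - g m)\<^sup>2) \<partial>\<mu>)"
  have "J \<le> (\<integral>\<^sup>+t. ennreal (2 * \<bar>g t - g m\<bar> * \<bar>D t\<bar>) * ennreal (\<mu>_min t) \<partial>lborel)"
    unfolding J_def by (rule median_square_bound[OF ac D N deriv m])
  also have "\<dots> \<le> (\<integral>\<^sup>+t. ennreal (1 / 2) * (ennreal (f t) * ennreal ((g t - g m)\<^sup>2)) +
      ennreal (2 / c\<^sup>2) * (ennreal (f t) * ennreal ((D t)\<^sup>2)) \<partial>lborel)"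
  proof (rule nn_integral_mono_AE)
    show "AE t in lborel. ennreal (2 * \<bar>g t - g m\<bar> * \<bar>D t\<bar>) * ennreal (\<mu>_min t) \<le>
      ennreal (1 / 2) * (ennreal (f t) * ennreal ((g t - g m)\<^sup>2)) +
      ennreal (2 / c\<^sup>2) * (ennreal (f t) * ennreal ((D t)\<^sup>2))"
      using isoperimetric_density_bound
    proof eventually_elim
      case (elim t)
      have eq: "ennreal (h * (p * a) + k * (p * b)) = ennreal h * (ennreal p * ennreal a) + ennreal k * (ennreal p * ennreal b)"
        if "h \<ge> 0" "k \<ge> 0" "p \<ge> 0" "a \<ge> 0" "b \<ge> 0" for h k p a b :: real
        using that by (simp add: ennreal_mult)
      define A B where "A = \<bar>g t - g m\<bar>" and "B = \<bar>D t\<bar>"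
      have f0: "f t > 0" by (rule pos)
      have "c * \<mu>_min t \<le> f t"
        using elim c f0 \<mu>_min_nonneg[of t] by (simp add: ennreal_mult[symmetric] ennreal_le_iff)
      then have "\<mu>_min t \<le> f t / c" using c by (simp add: field_simps)
      then have "2 * A * B * \<mu>_min t \<le> 2 * A * B * (f t / c)"
        by (intro mult_left_mono) (auto simp: A_def B_def)
      \<comment> \<open>Putting the whole factor 2 / c on \<open>B\<close> lets AM-GM place exactly
        1/2 on A^2 and 2 / c^2 on B^2.\<close>
      also have "\<dots> = f t * (A * (2 * B / c))" by simp
      also have "\<dots> \<le> f t * ((A\<^sup>2 + (2 * B / c)\<^sup>2) / 2)"
        using f0 sum_squares_bound[of A "2 * B / c"] by (intro mult_left_mono) auto
      also have "\<dots> = 1 / 2 * (f t * (g t - g m)\<^sup>2) + 2 / c\<^sup>2 * (f t * (D t)\<^sup>2)"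
        using c by (simp add: A_def B_def power_divide power_mult_distrib field_simps)
      finally have "2 * \<bar>g t - g m\<bar> * \<bar>D t\<bar> * \<mu>_min t \<le> 1 / 2 * (f t * (g t - g m)\<^sup>2) + 2 / c\<^sup>2 * (f t * (D t)\<^sup>2)"
        by (simp add: A_def B_def)
      then have "ennreal (2 * \<bar>g t - g m\<bar> * \<bar>D t\<bar> * \<mu>_min t) \<le>
          ennreal (1 / 2 * (f t * (g t - g m)\<^sup>2) + 2 / c\<^sup>2 * (f t * (D t)\<^sup>2))"
        by (rule ennreal_leI)
      also have "\<dots> = ennreal (1 / 2) * (ennreal (f t) * ennreal ((g t - g m)\<^sup>2)) +
          ennreal (2 / c\<^sup>2) * (ennreal (f t) * ennreal ((D t)\<^sup>2))"
        by (rule eq) (use f0 in auto)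
      also have "ennreal (2 * \<bar>g t - g m\<bar> * \<bar>D t\<bar> * \<mu>_min t) = ennreal (2 * \<bar>g t - g m\<bar> * \<bar>D t\<bar>) * ennreal (\<mu>_min t)"
        using \<mu>_min_nonneg by (rule ennreal_mult'')
      finally show ?case .
    qed
  qed
  also have "\<dots> = ennreal (1 / 2) * (\<integral>\<^sup>+t. ennreal (f t) * ennreal ((g t - g m)\<^sup>2) \<partial>lborel) +
      ennreal (2 / c\<^sup>2) * (\<integral>\<^sup>+t. ennreal (f t) * ennreal ((D t)\<^sup>2) \<partial>lborel)"
    by (subst nn_integral_add) (simp_all add: nn_integral_cmult)
  also have "\<dots> = ennreal (1 / 2) * J + ennreal (2 / c\<^sup>2) * deriv_norm_sq \<mu> g"
    using deriv_norm_sq_eq[OF D N deriv] by (simp add: J_def nn_integral_\<mu>)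
  finally have J: "J \<le> ennreal (1 / 2) * J + ennreal (2 / c\<^sup>2) * deriv_norm_sq \<mu> g" .
  \<comment> \<open>Finiteness allows J / 2 to be subtracted, which doubles 2 / c^2 to 4 /
    c^2.\<close>
  have "J < \<infinity>" unfolding J_def by (rule Var_le_nn_integral(2)[OF g2])
  then obtain j where j: "J = ennreal j" "j \<ge> 0" by (cases J) auto
  have "J \<le> ennreal (4 / c\<^sup>2) * deriv_norm_sq \<mu> g"
  proof (cases "deriv_norm_sq \<mu> g")
    case (real d)
    have "ennreal (h * j + k * d) = ennreal h * ennreal j + ennreal k * ennreal d" if "h \<ge> 0" "k \<ge> 0" for h k
      using that j(2) real(1) by (simp add: ennreal_mult)
    from this[of "1 / 2" "2 / c\<^sup>2"] have "ennreal j \<le> ennreal (1 / 2 * j + 2 / c\<^sup>2 * d)"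
      using J j(1) real(2) by simp
    then have "j \<le> 1 / 2 * j + 2 / c\<^sup>2 * d"
      using j(2) real(1) by (subst (asm) ennreal_le_iff) auto
    then have "j \<le> 4 / c\<^sup>2 * d" by simp
    then show ?thesis using j real c by (simp add: ennreal_mult[symmetric] ennreal_leI)
  next
    case top
    then show ?thesis using c by (simp add: ennreal_mult_top ennreal_eq_0_iff not_le)
  qed
  then show ?thesis using Var_le_nn_integral(1)[OF g2, of "g m"] by (simp add: J_def)
qed

lemma Var_le_Is:
  assumes g2: "in_L2 \<mu> g" and ac: "locally_abs_continuous g"
  shows "ennreal (Var \<mu> g) \<le> 4 * (inverse (Is \<mu>))\<^sup>2 * deriv_norm_sq \<mu> g"
proof (cases "Is \<mu> = 0")
  case True
  show ?thesis
  \<comment> \<open>The constant is infinite here, and so is the right side unless the norm is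
    0.\<close>
  proof (cases "deriv_norm_sq \<mu> g = 0")
    case True
    then show ?thesis using Var_zero_if_deriv_norm_sq_zero[OF assms] by simp
  next
    case False
    then show ?thesis using True by (simp add: ennreal_top_mult ennreal_mult_top power2_eq_square)
  qed
next
  case False
  then obtain c where c: "Is \<mu> = ennreal c" "c > 0"
    using Is_finite by (cases "Is \<mu>") (auto simp: ennreal_eq_0_iff not_le)
  have "4 * (inverse (Is \<mu>))\<^sup>2 = ennreal (4 / c\<^sup>2)"
    using c by (simp add: inverse_ennreal ennreal_power divide_inverse ennreal_mult power_inverse)
  then show ?thesis using Var_le_Is_positive[OF assms c] by simp
qed

text \<open>The value is shown to be one of the admissible constants. For positive
  \<open>Is \<mu>\<close> = c this is the variance inequality multiplied by c^2 / 4, since locally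
  Lipschitz functions are locally absolutely continuous.\<close>

lemma Is_le_poincare_const: "(Is \<mu>)\<^sup>2 / 4 \<le> poincare_const \<mu>"
  unfolding poincare_const_def
proof (rule Sup_upper, safe)
  fix g assume "locally_Lipschitz g" and g2: "in_L2 \<mu> g"
  then have ac: "locally_abs_continuous g" by (simp add: locally_Lipschitz_imp_abs_continuous)
  show "(Is \<mu>)\<^sup>2 / 4 * ennreal (Var \<mu> g) \<le> deriv_norm_sq \<mu> g"
  proof (cases "Is \<mu> = 0")
    case False
    then obtain c where c: "Is \<mu> = ennreal c" "c > 0"
      using Is_finite by (cases "Is \<mu>") (auto simp: ennreal_eq_0_iff not_le)
    have "(Is \<mu>)\<^sup>2 / 4 = ennreal (c\<^sup>2 / 4)"
      using c by (simp add: ennreal_power divide_ennreal[symmetric])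
    then have "(Is \<mu>)\<^sup>2 / 4 * ennreal (Var \<mu> g) \<le> ennreal (c\<^sup>2 / 4) * (ennreal (4 / c\<^sup>2) * deriv_norm_sq \<mu> g)"
      using Var_le_Is_positive[OF g2 ac c] by (simp add: mult_left_mono)
    also have "\<dots> = ennreal (c\<^sup>2 / 4 * (4 / c\<^sup>2)) * deriv_norm_sq \<mu> g"
      using c by (simp only: ennreal_mult mult.assoc divide_nonneg_nonneg zero_le_power2 zero_le_numeral)
    also have "c\<^sup>2 / 4 * (4 / c\<^sup>2) = 1" using c by simp
    finally show ?thesis by simp
  qed simp
qed

end

theorem corollary3p1:
  fixes \<mu> :: "real measure" and f :: "real \<Rightarrow> real"
  assumes "prob_space \<mu>"
    and "f \<in> borel_measurable borel"
    and "\<And>x. f x > 0"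
    and "\<mu> = density lborel (\<lambda>x. ennreal (f x))"
  shows "(\<forall>g. in_L2 \<mu> g \<longrightarrow> locally_abs_continuous g \<longrightarrow>
            ennreal (Var \<mu> g) \<le> 4 * (inverse (Is \<mu>))\<^sup>2 * deriv_norm_sq \<mu> g)
         \<and> (Is \<mu>)\<^sup>2 / 4 \<le> poincare_const \<mu>"
proof -
  interpret positive_density_prob \<mu> f
    using assms by (simp add: positive_density_prob_def positive_density_prob_axioms_def)
  show ?thesis using Var_le_Is Is_le_poincare_const by blast
qed

end
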